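(* Let $t \ge 2$ and $0 < r \le t$ be integers. For all integers $n > \frac{400 t^2}{3}$ we have $$\left| D_{r,t}(n) - \frac{\log 2}{t} V_0(n) + \frac12 B_1\!\left(\tfrac rt\right) V_1(n) - \frac t8 B_2\!\left(\tfrac rt\right) V_2(n) + \frac{t^3}{192} B_4\!\left(\tfrac rt\right) V_4(n) \right| \le \mathrm{Err}_t(n).$$
   Context: A partition into distinct parts is a partition no two of whose parts are equal; let $\mathcal D$ be the set of such partitions. For integers $0<r\le t$ and $n\ge 0$, $D_{r,t}(n)$ is the total number of parts congruent to $r$ modulo $t$ among all partitions of $n$ into distinct parts: $D_{r,t}(n)=\sum_{\lambda\in\mathcal D,\ |\lambda|=n}\#\{\lambda_i\in\lambda:\lambda_i\equiv r \pmod t\}$. $B_m(x)$ denotes the Bernoulli polynomials, $\sum_{m\ge0}B_m(x)\frac{u^m}{m!}=\frac{ue^{xu}}{e^u-1}$. With $\eta=\frac{\pi}{\sqrt{12n}}$, for integers $s\ge 0$ define $$V_s(n)=\frac{1}{2\pi\sqrt2\, i}\int_{D_0} z^{s-1}\exp\!\left(\frac{\pi^2}{12z}+\left(n+\frac1{24}\right)z\right)dz,$$ where $D_0$ is the vertical segment from $\eta-10\eta i$ to $\eta+10\eta i$. Finally, $$\mathrm{Err}_t(n)=\frac{14381\,t^5}{n^3}\exp\!\left(\pi\sqrt{\tfrac n3}\right)+\frac{945285959087}{t\,n^4}\exp\!\left(\pi\sqrt{\tfrac n3}\right)+9n\exp\!\left(\left(\frac{3\sqrt3}{2\pi}+\frac{\pi}{\sqrt{12}}\right)\sqrt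 n\right).$$ *)

theory Defs
  imports
    "HOL-Complex_Analysis.Complex_Analysis"
    "HOL-Number_Theory.Cong"
    "HOL-Library.Multiset"
begin

definition distinct_partitions :: "nat \<Rightarrow> nat multiset set" where
  "distinct_partitions n =
     {P. (\<forall>p\<in>#P. 0 < p) \<and> (\<forall>p. count P p \<le> 1) \<and> \<Sum>\<^sub># P = n}"

definition D :: "nat \<Rightarrow> nat \<Rightarrow> nat \<Rightarrow> nat" where
  "D r t n = (\<Sum>P\<in>distinct_partitions n. size {#p \<in># P. [p = r] (mod t)#})"

text \<open>The sum in \<^const>\<open>D\<close> is a genuine finite sum:\<close>

lemma finite_distinct_partitions: "finite (distinct_partitions n)"
proof -
  have "distinct_partitions n \<subseteq> mset_set ` Pow {..n}"
  proof
    fix P assume P: "P \<in> distinct_partitions n"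
    have "P = mset_set (set_mset P)"
    proof (rule multiset_eqI)
      fix p
      have "count P p \<le> 1" using P by (simp add: distinct_partitions_def)
      then have "count P p = 0 \<or> count P p = 1" by linarith
      then have "count P p = (if p \<in># P then 1 else 0)"
        by (metis not_in_iff zero_neq_one)
      then show "count P p = count (mset_set (set_mset P)) p"
        by (cases "p \<in># P") (simp_all only: count_mset_set finite_set_mset if_True if_False not_False_eq_True)
    qed
    moreover have "set_mset P \<subseteq> {..n}"
    proof
      fix p assume "p \<in># P"
      then have "p \<le> \<Sum>\<^sub># P" by (auto dest!: multi_member_split)
      then show "p \<in> {..n}" using P by (simp add: distinct_partitions_def)
    qed
    ultimately show "P \<in> mset_set ` Pow {..n}" by blast
  qed
  then show ?thesis by (rule finite_subset) simp
qed

text \<open>The exponential generating function \<open>u e\<^bsup>x u\<^esup> / (e\<^bsup>u\<^esup> - 1)\<close> of the Bernoulli polynomials,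
  as a formal power series in \<open>u\<close>. Both numerator and denominator have zero constant term; the
  lemma below confirms that the division of formal power series is exact.\<close>

definition bernoulli_gf :: "real \<Rightarrow> real fps" where
  "bernoulli_gf x = fps_X * fps_exp x / (fps_exp 1 - 1)"

definition bernpoly :: "nat \<Rightarrow> real \<Rightarrow> real" where
  "bernpoly m x = fact m * fps_nth (bernoulli_gf x) m"

lemma bernoulli_gf_mult:
  "bernoulli_gf x * (fps_exp 1 - 1) = fps_X * fps_exp x"
proof -
  have "subdegree (fps_exp (1::real) - 1) = 1"
    by (rule subdegreeI) auto
  moreover have "subdegree (fps_X * fps_exp x) = 1"
    by (rule subdegreeI) auto
  ultimately have "(fps_exp (1::real) - 1) dvd fps_X * fps_exp x"
    by (subst fps_dvd_iff) auto
  then show ?thesis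
    unfolding bernoulli_gf_def by (rule dvd_div_mult_self)
qed

definition eta :: "nat \<Rightarrow> real" where
  "eta n = pi / sqrt (12 * real n)"

definition V_integrand :: "nat \<Rightarrow> nat \<Rightarrow> complex \<Rightarrow> complex" where
  "V_integrand s n z =
     z powi (int s - 1) * exp (complex_of_real (pi\<^sup>2) / (12 * z) + (of_nat n + 1 / 24) * z)"

definition V_path :: "nat \<Rightarrow> real \<Rightarrow> complex" where
  "V_path n = linepath (Complex (eta n) (- 10 * eta n)) (Complex (eta n) (10 * eta n))"

definition V :: "nat \<Rightarrow> nat \<Rightarrow> complex" where
  "V s n = 1 / (2 * of_real pi * of_real (sqrt 2) * \<i>) *
     contour_integral (V_path n) (V_integrand s n)"

lemma V_integrand_contour_integrable:
  assumes "n > 0"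
  shows "V_integrand s n contour_integrable_on V_path n"
proof -
  have "eta n > 0" using assms by (simp add: eta_def)
  have *: "Re z = eta n"
    if "z \<in> closed_segment (Complex (eta n) (- 10 * eta n)) (Complex (eta n) (10 * eta n))" for z
    using that by (auto simp: in_segment simp flip: distrib_right)
  then have "z \<noteq> 0"
    if "z \<in> closed_segment (Complex (eta n) (- 10 * eta n)) (Complex (eta n) (10 * eta n))" for z
    using that \<open>eta n > 0\<close> by (metis less_irrefl zero_complex.sel(1))
  then show ?thesis
    unfolding V_path_def V_integrand_def
    by (intro contour_integrable_continuous_linepath continuous_intros) auto
qed

definition Err :: "nat \<Rightarrow> nat \<Rightarrow> real" where
  "Err t n =
     14381 * real t ^ 5 / real n ^ 3 * exp (pi * sqrt (real n / 3)) +
     945285959087 / (real t * real n ^ 4) * exp (pi * sqrt (real n / 3)) +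
     9 * real n * exp ((3 * sqrt 3 / (2 * pi) + pi / sqrt 12) * sqrt (real n))"

end

theory Submission
  imports Defs
begin

text \<open>
  Write \<open>q = e\<^bsup>-z\<^esup>\<close> with \<open>z = \<eta> + i y\<close>. The generating function of \<^const>\<open>D\<close> is the product of
  \<open>\<Prod>(1 + q\<^sup>k)\<close> and \<open>\<Sum> q\<^sup>k / (1 + q\<^sup>k)\<close>, the sum being over \<open>k \<equiv> r\<close> modulo \<open>t\<close>, and
  \<open>2 \<pi> D(n)\<close> is the integral of this product times \<open>e\<^bsup>n z\<^esup>\<close> over \<open>-\<pi> \<le> y \<le> \<pi>\<close>.
  Both the sum and the logarithm of the product are sums of a function along the ray through \<open>z\<close>,
  namely of the Fermi function \<open>1 / (1 + e\<^sup>w)\<close> and of its antiderivative up to sign \<open>log (1 + e\<^bsup>-w\<^esup>)\<close>, so one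
  Euler--Maclaurin formula for complex step size handles both. In the first case it produces the
  Bernoulli terms of the theorem; in the second, nearly all coefficients vanish, leaving
  \<open>\<pi>\<^sup>2 / (12 z) - (log 2) / 2 + z / 24\<close> up to \<open>O(|z|\<^sup>6)\<close>.

  These expansions are only used for \<open>|y| \<le> \<eta>\<close>, where they account for the first term of \<^const>\<open>Err\<close>.
  For \<open>\<eta> \<le> |y| \<le> \<pi>\<close> the product is already smaller than its value at \<open>y = 0\<close> by an exponential
  factor, because \<open>|1 + q\<^sup>k| \<le> (1 + |q|\<^sup>k) exp (- |q|\<^sup>k (1 - cos k y) / 4)\<close>; this leaves
  \<open>exp (3 / (4 \<eta>))\<close>, which times \<open>e\<^bsup>n \<eta>\<^esup>\<close> is the exponential in the third term of \<^const>\<open>Err\<close>. The part of \<^const>\<open>V\<close> with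
  \<open>\<eta> \<le> |y| \<le> 10 \<eta>\<close> is absorbed by the same term, and the second term of \<^const>\<open>Err\<close> is pure slack.
\<close>

subsection \<open>Euler--Maclaurin summation along a ray\<close>

definition bernoulli_coeff :: "nat \<Rightarrow> real \<Rightarrow> real" where
  "bernoulli_coeff j a = fps_nth (bernoulli_gf a) j"

lemma bernpoly_eq: "bernpoly m a = fact m * bernoulli_coeff m a"
  by (simp add: bernpoly_def bernoulli_coeff_def)

text \<open>Compares the coefficients of \<open>X^k\<close> in
  \<open>bernoulli_gf a * (fps_exp 1 - 1) = fps_X * fps_exp a\<close>; the conditional on the left
  reflects the missing constant term of \<open>fps_exp 1 - 1\<close>.\<close>

lemma sum_bernoulli_coeff:
  "(\<Sum>j\<le>k. bernoulli_coeff j a * (if k - j = 0 then 0 else 1 / fact (k - j)))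
     = (if k = 0 then 0 else a ^ (k - 1) / fact (k - 1))"
proof -
  have "fps_nth (bernoulli_gf a * (fps_exp 1 - 1)) k
      = (\<Sum>j\<le>k. bernoulli_coeff j a * (if k - j = 0 then 0 else 1 / fact (k - j)))"
    unfolding fps_mult_nth bernoulli_coeff_def atLeast0AtMost
    by (intro sum.cong) auto
  then show ?thesis
    unfolding bernoulli_gf_mult by (simp add: fps_X_mult_nth split: if_splits)
qed

text \<open>The case \<open>k = m + 1\<close> of \<open>sum_bernoulli_coeff\<close> contains
  \<open>bernoulli_coeff m a\<close> with factor 1, so the values can be solved for one after
  another.\<close>

lemma bernoulli_coeffs:
  "bernoulli_coeff 0 a = 1"
  "bernoulli_coeff 1 a = a - 1/2"
  "bernoulli_coeff 2 a = (6*a^2 - 6*a + 1) / 12"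
  "bernoulli_coeff 3 a = (2*a^3 - 3*a^2 + a) / 12"
  "bernoulli_coeff 4 a = (30*a^4 - 60*a^3 + 30*a^2 - 1) / 720"
  "bernoulli_coeff 5 a = (6*a^5 - 15*a^4 + 10*a^3 - a) / 720"
  "bernoulli_coeff 6 a = (42*a^6 - 126*a^5 + 105*a^4 - 21*a^2 + 1) / 30240"
  "bernoulli_coeff 7 a = (6*a^7 - 21*a^6 + 21*a^5 - 7*a^3 + a) / 30240"
proof -
  note [simp] = atMost_Suc atMost_nat_numeral fact_numeral
  show b0: "bernoulli_coeff 0 a = 1" using sum_bernoulli_coeff[of a 1] by simp
  show b1: "bernoulli_coeff 1 a = a - 1/2"
    using sum_bernoulli_coeff[of a 2] b0 by (simp add: field_simps)
  show b2: "bernoulli_coeff 2 a = (6*a^2 - 6*a + 1) / 12"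
    using sum_bernoulli_coeff[of a 3] b0 b1[simplified] by (simp add: field_simps)
  show b3: "bernoulli_coeff 3 a = (2*a^3 - 3*a^2 + a) / 12"
    using sum_bernoulli_coeff[of a 4] b0 b1[simplified] b2 by (simp add: field_simps)
  show b4: "bernoulli_coeff 4 a = (30*a^4 - 60*a^3 + 30*a^2 - 1) / 720"
    using sum_bernoulli_coeff[of a 5] b0 b1[simplified] b2 b3 by (simp add: field_simps)
  show b5: "bernoulli_coeff 5 a = (6*a^5 - 15*a^4 + 10*a^3 - a) / 720"
    using sum_bernoulli_coeff[of a 6] b0 b1[simplified] b2 b3 b4 by (simp add: field_simps)
  show b6: "bernoulli_coeff 6 a = (42*a^6 - 126*a^5 + 105*a^4 - 21*a^2 + 1) / 30240"
    using sum_bernoulli_coeff[of a 7] b0 b1[simplified] b2 b3 b4 b5 by (simp add: field_simps)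
  show b7: "bernoulli_coeff 7 a = (6*a^7 - 21*a^6 + 21*a^5 - 7*a^3 + a) / 30240"
    using sum_bernoulli_coeff[of a 8] b0 b1[simplified] b2 b3 b4 b5 b6 by (simp add: field_simps)
qed

text \<open>Collects the Taylor remainder constants of one summation step: the sum comes from
  expanding each \<open>f j\<close> to order \<open>N - j\<close>, the last term from expanding
  \<open>f 1\<close> at the shifted point.\<close>

definition em_const :: "nat \<Rightarrow> real \<Rightarrow> real" where
  "em_const N a = (\<Sum>j\<le>N. \<bar>bernoulli_coeff j a\<bar> / fact (N - j)) + 1 / fact (N - 1)"

text \<open>
  The sum \<open>\<Sum>\<^sub>j b\<^sub>j u\<^sup>j f\<^sub>j(w)\<close> is an approximate antidifference with step \<open>u\<close> of \<open>u f\<^sub>1(w + a u)\<close>: formally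
  \<open>(e\<^bsup>uD\<^esup> - 1) uD e\<^bsup>a uD\<^esup> / (e\<^bsup>uD\<^esup> - 1) = uD e\<^bsup>a uD\<^esup>\<close>, and \<open>b\<^sub>j\<close> are the coefficients of the second factor.
\<close>

lemma euler_maclaurin_step:
  fixes f :: "nat \<Rightarrow> complex \<Rightarrow> complex" and u :: complex and a :: real
  assumes "0 \<le> a" "a \<le> 1" and "N \<ge> 1"
    and der: "\<And>j x. j \<le> N \<Longrightarrow> x \<in> closed_segment w (w + u) \<Longrightarrow> (f j has_field_derivative f (Suc j) x) (at x)"
    and bound: "\<And>x. x \<in> closed_segment w (w + u) \<Longrightarrow> norm (f (Suc N) x) \<le> B"
  shows "norm ((\<Sum>j\<le>N. bernoulli_coeff j a * u ^ j * (f j (w + u) - f j w)) - u * f 1 (w + a * u))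
      \<le> B * norm u ^ Suc N * em_const N a"
proof -
  let ?S = "closed_segment w (w + u)"
  define b where "b = (\<lambda>j. bernoulli_coeff j a)"
  define c :: "nat \<Rightarrow> real" where "c = (\<lambda>i. if i = 0 then 0 else 1 / fact i)"
  \<comment> \<open>Every expansion stops at the derivative \<open>f N\<close>, so all remainders
    are controlled by \<open>f (Suc N)\<close> alone: \<open>T j\<close> is the Taylor polynomial of
    \<open>f j\<close> at \<open>w + u\<close>, while \<open>E j\<close> and \<open>E'\<close> are
    remainders.\<close>
  define T where "T = (\<lambda>j. \<Sum>i\<le>N - j. f (j + i) w * u ^ i / fact i)"
  define E where "E = (\<lambda>j. f j (w + u) - T j)"
  define E' where "E' = f 1 (w + a * u) - (\<Sum>i\<le>N - 1. f (1 + i) w * (a * u) ^ i / fact i)"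
  obtain M where M: "N = Suc M" using assms(3) by (cases N) auto
  have "B \<ge> 0" by (rule order.trans[OF norm_ge_zero bound[of w]]) simp
  have E: "norm (E j) \<le> B * norm u ^ Suc (N - j) / fact (N - j)" if "j \<le> N" for j
  proof -
    have "norm (f (j + 0) (w + u) - (\<Sum>i\<le>N - j. f (j + i) w * ((w + u) - w) ^ i / fact i))
        \<le> B * norm ((w + u) - w) ^ Suc (N - j) / fact (N - j)"
      using that der bound
      by (intro complex_Taylor[where S = ?S and f = "\<lambda>i. f (j + i)"])
         (auto intro: has_field_derivative_at_within)
    then show ?thesis by (simp add: E_def T_def)
  qed
  have au: "w + a * u \<in> ?S"
    using assms by (auto simp: in_segment algebra_simps scaleR_conv_of_real intro!: exI[of _ a])
  have "norm (f (1 + 0) (w + a * u) - (\<Sum>i\<le>N - 1. f (1 + i) w * ((w + a * u) - w) ^ i / fact i))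
        \<le> B * norm ((w + a * u) - w) ^ Suc (N - 1) / fact (N - 1)"
    using au der bound M
    by (intro complex_Taylor[where S = ?S and f = "\<lambda>i. f (1 + i)"])
       (auto intro: has_field_derivative_at_within)
  also have "\<dots> \<le> B * norm u ^ Suc (N - 1) / fact (N - 1)"
    using \<open>B \<ge> 0\<close> assms
    by (intro divide_right_mono mult_left_mono power_mono) (auto simp: norm_mult intro: mult_left_le_one_le)
  finally have E': "norm E' \<le> B * norm u ^ N / fact (N - 1)"
    using assms by (simp add: E'_def)

  have T: "T j - f j w = (\<Sum>i\<le>N - j. f (j + i) w * u ^ i * c i)" for j
    unfolding T_def c_def
    by (subst (1 2) sum.atMost_shift) (auto intro!: sum.cong)
  have "(\<Sum>j\<le>N. b j * u ^ j * (T j - f j w))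
      = (\<Sum>j\<le>N. \<Sum>i\<le>N - j. f (j + i) w * u ^ (j + i) * (b j * c i))"
    unfolding T sum_distrib_left by (intro sum.cong) (auto simp: power_add)
  \<comment> \<open>Grouping by the total order \<open>k = i + j\<close> turns the inner sum into
    the convolution that \<open>sum_bernoulli_coeff\<close> evaluates.\<close>
  also have "\<dots> = (\<Sum>k\<le>N. \<Sum>j\<le>k. f k w * u ^ k * (b j * c (k - j)))"
  proof -
    have "(\<Sum>j\<le>N. \<Sum>i\<le>N - j. f (j + i) w * u ^ (j + i) * (b j * c i))
        = (\<Sum>(j, i)\<in>(SIGMA j:{..N}. {..N - j}). f (j + i) w * u ^ (j + i) * (b j * c i))"
      by (simp add: sum.Sigma)
    also have "(SIGMA j:{..N}. {..N - j}) = {(j, i). j + i \<le> N}"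
      by auto
    also have "(\<Sum>(j, i)\<in>{(j, i). j + i \<le> N}. f (j + i) w * u ^ (j + i) * (b j * c i))
        = (\<Sum>k\<le>N. \<Sum>j\<le>k. f (j + (k - j)) w * u ^ (j + (k - j)) * (b j * c (k - j)))"
      by (rule sum.triangle_reindex_eq)
    also have "\<dots> = (\<Sum>k\<le>N. \<Sum>j\<le>k. f k w * u ^ k * (b j * c (k - j)))"
      by (intro sum.cong) auto
    finally show ?thesis .
  qed
  also have "\<dots> = (\<Sum>k\<le>N. f k w * u ^ k * of_real (\<Sum>j\<le>k. b j * c (k - j)))"
    by (simp add: sum_distrib_left)
  also have "\<dots> = (\<Sum>k\<le>N. f k w * u ^ k * of_real (if k = 0 then 0 else a ^ (k - 1) / fact (k - 1)))"
    unfolding b_def c_def sum_bernoulli_coeff ..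
  also have "\<dots> = (\<Sum>i\<le>M. f (Suc i) w * u ^ Suc i * (a ^ i / fact i))"
    unfolding M by (subst sum.atMost_Suc_shift) simp
  also have "\<dots> = u * (\<Sum>i\<le>M. f (Suc i) w * (a * u) ^ i / fact i)"
    by (simp add: sum_distrib_left power_mult_distrib mult_ac)
  finally have main: "(\<Sum>j\<le>N. b j * u ^ j * (T j - f j w)) = u * (f 1 (w + a * u) - E')"
    by (simp add: E'_def M)

  have "(\<Sum>j\<le>N. b j * u ^ j * (f j (w + u) - f j w)) =
      (\<Sum>j\<le>N. b j * u ^ j * (T j - f j w)) + (\<Sum>j\<le>N. b j * u ^ j * E j)"
    by (simp add: E_def algebra_simps sum.distrib sum_subtractf)
  then have "(\<Sum>j\<le>N. b j * u ^ j * (f j (w + u) - f j w)) - u * f 1 (w + a * u)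
      = (\<Sum>j\<le>N. b j * u ^ j * E j) - u * E'"
    unfolding main by (simp add: algebra_simps)
  also have "norm \<dots> \<le> (\<Sum>j\<le>N. norm (b j * u ^ j * E j)) + norm (u * E')"
    by (intro order.trans[OF norm_triangle_ineq4] add_mono norm_sum order.refl)
  also have "\<dots> \<le> (\<Sum>j\<le>N. \<bar>b j\<bar> * norm u ^ j * (B * norm u ^ Suc (N - j) / fact (N - j)))
      + norm u * (B * norm u ^ N / fact (N - 1))"
    unfolding norm_mult norm_power norm_of_real
    by (intro add_mono sum_mono mult_left_mono E E') auto
  also have "(\<Sum>j\<le>N. \<bar>b j\<bar> * norm u ^ j * (B * norm u ^ Suc (N - j) / fact (N - j)))
      = (\<Sum>j\<le>N. B * norm u ^ Suc N * (\<bar>b j\<bar> / fact (N - j)))"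
  proof (rule sum.cong)
    fix j assume "j \<in> {..N}"
    then have "norm u ^ N = norm u ^ j * norm u ^ (N - j)"
      by (subst power_add[symmetric]) auto
    then show "\<bar>b j\<bar> * norm u ^ j * (B * norm u ^ Suc (N - j) / fact (N - j))
        = B * norm u ^ Suc N * (\<bar>b j\<bar> / fact (N - j))" by simp
  qed simp
  also have "\<dots> + norm u * (B * norm u ^ N / fact (N - 1)) = B * norm u ^ Suc N * em_const N a"
    by (simp add: em_const_def b_def sum_distrib_left algebra_simps)
  finally show ?thesis by (simp add: b_def)
qed

text \<open>The single step is applied at \<open>w = m * u\<close> for every \<open>m\<close>. The
  antidifferences telescope, and as they vanish at infinity only their value at 0 survives, with a
  minus sign; the errors form a geometric series of ratio \<open>exp (- c)\<close>.\<close>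

lemma euler_maclaurin_ray:
  fixes f :: "nat \<Rightarrow> complex \<Rightarrow> complex" and u :: complex and a c K :: real
  assumes "0 \<le> a" "a \<le> 1" and "N \<ge> 1" and "c > 0" and "u \<noteq> 0"
    and der: "\<And>j x. j \<le> N \<Longrightarrow> x \<ge> 0 \<Longrightarrow>
        (f j has_field_derivative f (Suc j) (of_real x * u)) (at (of_real x * u))"
    and bound: "\<And>x. x \<ge> 0 \<Longrightarrow> norm (f (Suc N) (of_real x * u)) \<le> K * exp (- c * x)"
    and lim: "\<And>j. j \<le> N \<Longrightarrow> (\<lambda>m. f j (of_nat m * u)) \<longlonglongrightarrow> 0"
  obtains S where "(\<lambda>m. f 1 ((of_nat m + of_real a) * u)) sums S"
    and "norm (S + (\<Sum>j\<le>N. bernoulli_coeff j a * u ^ j * f j 0) / u)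
      \<le> K * norm u ^ N / (1 - exp (- c)) * em_const N a"
proof -
  define G where "G = (\<lambda>m. \<Sum>j\<le>N. bernoulli_coeff j a * u ^ j * f j (of_nat m * u))"
  define R where "R = (\<lambda>m. G (Suc m) - G m - u * f 1 ((of_nat m + of_real a) * u))"
  define C where "C = K * norm u ^ Suc N * em_const N a"
  have R: "norm (R m) \<le> C * exp (- c) ^ m" for m
  proof -
    let ?S = "closed_segment (of_nat m * u) (of_nat m * u + u)"
    have S: "\<exists>x\<ge>real m. z = of_real x * u" if "z \<in> ?S" for z
    proof -
      from that obtain s where "s \<ge> 0" "z = (1 - s) *\<^sub>R (of_nat m * u) + s *\<^sub>R (of_nat m * u + u)"
        by (auto simp: in_segment)
      then have "z = of_real (real m + s) * u"
        by (simp add: scaleR_conv_of_real algebra_simps)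
      with \<open>s \<ge> 0\<close> show ?thesis by (intro exI[of _ "real m + s"]) auto
    qed
    have K: "K \<ge> 0" using order.trans[OF norm_ge_zero bound[of 0]] by simp
    have "norm ((\<Sum>j\<le>N. bernoulli_coeff j a * u ^ j * (f j (of_nat m * u + u) - f j (of_nat m * u)))
          - u * f 1 (of_nat m * u + a * u))
      \<le> K * exp (- c) ^ m * norm u ^ Suc N * em_const N a"
    proof (rule euler_maclaurin_step)
      fix z assume "z \<in> ?S"
      then obtain x where x: "x \<ge> real m" "z = of_real x * u" using S by blast
      then have "norm (f (Suc N) z) \<le> K * exp (- c * x)" using bound[of x] by simp
      also have "\<dots> \<le> K * exp (- c * m)"
        using x K \<open>c > 0\<close> by (intro mult_left_mono) auto
      also have "exp (- c * m) = exp (- c) ^ m"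
        by (simp flip: exp_of_nat2_mult)
      finally show "norm (f (Suc N) z) \<le> K * exp (- c) ^ m" .
    next
      fix j z assume "j \<le> N" "z \<in> ?S"
      then show "(f j has_field_derivative f (Suc j) z) (at z)"
        using S[of z] der by force
    qed (use assms in auto)
    also have "(\<Sum>j\<le>N. bernoulli_coeff j a * u ^ j * (f j (of_nat m * u + u) - f j (of_nat m * u)))
          - u * f 1 (of_nat m * u + a * u) = R m"
      by (simp add: R_def G_def algebra_simps sum_subtractf)
    finally show ?thesis by (simp add: C_def mult_ac)
  qed
  have ec: "exp (- c) < 1" using \<open>c > 0\<close> by simp
  have geo: "(\<lambda>m. C * exp (- c) ^ m) sums (C * (1 / (1 - exp (- c))))"
    using ec by (intro sums_mult geometric_sums) auto
  have "summable R" "norm (suminf R) \<le> C * (1 / (1 - exp (- c)))"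
  proof -
    show "summable R"
      by (rule summable_comparison_test'[OF sums_summable[OF geo]]) (use R in auto)
    have "norm (suminf R) \<le> suminf (\<lambda>m. C * exp (- c) ^ m)"
      by (rule norm_suminf_le[OF R sums_summable[OF geo]])
    then show "norm (suminf R) \<le> C * (1 / (1 - exp (- c)))"
      using sums_unique[OF geo] by simp
  qed
  have "G \<longlonglongrightarrow> (\<Sum>j\<le>N. bernoulli_coeff j a * u ^ j * 0)"
    unfolding G_def by (intro tendsto_intros lim) auto
  then have tel: "(\<lambda>m. G (Suc m) - G m) sums (0 - G 0)"
    by (intro telescope_sums) simp
  have "(\<lambda>m. (G (Suc m) - G m - R m) / u) sums ((0 - G 0 - suminf R) / u)"
    by (rule sums_divide[OF sums_diff[OF tel summable_sums[OF \<open>summable R\<close>]]])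
  also have "(\<lambda>m. (G (Suc m) - G m - R m) / u) = (\<lambda>m. f 1 ((of_nat m + of_real a) * u))"
    using \<open>u \<noteq> 0\<close> by (simp add: R_def fun_eq_iff)
  finally have "(\<lambda>m. f 1 ((of_nat m + of_real a) * u)) sums ((0 - G 0 - suminf R) / u)" .
  moreover have "norm ((0 - G 0 - suminf R) / u + (\<Sum>j\<le>N. bernoulli_coeff j a * u ^ j * f j 0) / u)
      = norm (suminf R) / norm u"
    by (simp add: G_def norm_divide diff_divide_distrib)
  moreover have "norm (suminf R) / norm u \<le> C * (1 / (1 - exp (- c))) / norm u"
    by (intro divide_right_mono norm_ge_zero) fact
  moreover have "C * (1 / (1 - exp (- c))) / norm u = K * norm u ^ N / (1 - exp (- c)) * em_const N a"
    using \<open>u \<noteq> 0\<close> by (simp add: C_def)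
  ultimately show ?thesis using that by simp
qed

subsection \<open>Derivatives and antiderivatives of the Fermi function\<close>

definition fermi :: "complex \<Rightarrow> complex" where
  "fermi w = 1 / (1 + exp w)"

text \<open>
  Since \<^const>\<open>fermi\<close> satisfies \<open>f' = f\<^sup>2 - f\<close>, its derivatives are polynomials in \<open>f\<close>.
\<close>

primrec fermi_poly :: "nat \<Rightarrow> complex poly" where
  "fermi_poly 0 = [:0, 1:]"
| "fermi_poly (Suc k) = pderiv (fermi_poly k) * [:0, -1, 1:]"

lemma fermi_polys:
  "fermi_poly 1 = [:0, -1, 1:]"
  "fermi_poly 2 = [:0, 1, -3, 2:]"
  "fermi_poly 3 = [:0, -1, 7, -12, 6:]"
  "fermi_poly 4 = [:0, 1, -15, 50, -60, 24:]"
  "fermi_poly 5 = [:0, -1, 31, -180, 390, -360, 120:]"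
  "fermi_poly 6 = [:0, 1, -63, 602, -2100, 3360, -2520, 720:]"
proof -
  show 1: "fermi_poly 1 = [:0, -1, 1:]" by (simp add: pderiv_pCons)
  show 2: "fermi_poly 2 = [:0, 1, -3, 2:]"
    using fermi_poly.simps(2)[of 1] 1 by (simp add: pderiv_pCons numeral_2_eq_2)
  show 3: "fermi_poly 3 = [:0, -1, 7, -12, 6:]"
    using fermi_poly.simps(2)[of 2] unfolding 2 by (simp add: pderiv_pCons)
  show 4: "fermi_poly 4 = [:0, 1, -15, 50, -60, 24:]"
    using fermi_poly.simps(2)[of 3] unfolding 3 by (simp add: pderiv_pCons)
  show 5: "fermi_poly 5 = [:0, -1, 31, -180, 390, -360, 120:]"
    using fermi_poly.simps(2)[of 4] unfolding 4 by (simp add: pderiv_pCons)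
  show 6: "fermi_poly 6 = [:0, 1, -63, 602, -2100, 3360, -2520, 720:]"
    using fermi_poly.simps(2)[of 5] unfolding 5 by (simp add: pderiv_pCons)
qed

lemma poly_fermi_poly_0 [simp]: "poly (fermi_poly k) 0 = 0"
  by (cases k) auto

lemma has_field_derivative_fermi_poly:
  assumes "1 + exp w \<noteq> 0"
  shows "((\<lambda>w. poly (fermi_poly k) (fermi w)) has_field_derivative poly (fermi_poly (Suc k)) (fermi w)) (at w)"
proof -
  have "((\<lambda>w. 1 / (1 + exp w)) has_field_derivative (- exp w / (1 + exp w)\<^sup>2)) (at w)"
    using assms by (auto intro!: derivative_eq_intros simp: power2_eq_square)
  also have "- exp w / (1 + exp w)\<^sup>2 = fermi w ^ 2 - fermi w"
    using assms by (simp add: fermi_def divide_simps) (simp add: power2_eq_square algebra_simps)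
  also have "(\<lambda>w. 1 / (1 + exp w)) = fermi" by (simp add: fermi_def fun_eq_iff)
  finally have "(fermi has_field_derivative (fermi w ^ 2 - fermi w)) (at w)" .
  then have "((\<lambda>w. poly (fermi_poly k) (fermi w)) has_field_derivative
      poly (pderiv (fermi_poly k)) (fermi w) * (fermi w ^ 2 - fermi w)) (at w)"
    using DERIV_chain2[OF poly_DERIV] by blast
  then show ?thesis by (simp add: algebra_simps power2_eq_square)
qed

section \<open>Size of the Fermi function in a sector\<close>

lemma exp_ge_4:
  fixes x :: real
  assumes "x \<ge> 3/2"
  shows "exp x \<ge> 4"
proof -
  have "(2::real) \<le> exp (3/4)"
    using exp_lower_Taylor_quadratic[of "3/4"] by (simp add: power2_eq_square)
  then have "2 * 2 \<le> exp (3/4) * exp (3/4 :: real)"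
    by (intro mult_mono) auto
  also have "\<dots> = exp (3/2 :: real)" by (simp flip: exp_add)
  also have "\<dots> \<le> exp x" using assms by simp
  finally show ?thesis by simp
qed

text \<open>If the imaginary part is at most \<open>pi / 2\<close> in size, the cosine is
  nonnegative and \<open>norm (1 + exp w) ^ 2\<close> is at least \<open>1 + exp (2 * Re w)\<close>.
  Otherwise the sector condition forces \<open>Re w > 3/2\<close>, so \<open>exp w\<close> has norm
  at least 4 and dominates the 1.\<close>

lemma norm_fermi_sector:
  assumes "\<bar>Im w\<bar> \<le> Re w"
  shows "norm (fermi w) \<le> 3/4" "norm (fermi w) \<le> 4/3 * exp (- Re w)" "1 + exp w \<noteq> 0"
proof -
  define x where "x = Re w"
  have x: "x \<ge> 0" using assms by (simp add: x_def)
  have "norm (1 + exp w) \<ge> 4/3 \<and> norm (1 + exp w) \<ge> 3/4 * exp x"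
  proof (cases "\<bar>Im w\<bar> \<le> pi / 2")
    case True
    have "norm (1 + exp w) ^ 2 = (1 + exp x * cos (Im w))\<^sup>2 + (exp x * sin (Im w))\<^sup>2"
      by (simp add: cmod_power2 Re_exp Im_exp x_def)
    also have "\<dots> = 1 + 2 * (exp x * cos (Im w)) + (exp x)\<^sup>2"
      using sin_cos_squared_add[of "Im w"] by algebra
    also have "\<dots> \<ge> 1 + (exp x)\<^sup>2"
      using True cos_ge_zero[of "Im w"] by simp
    finally have *: "norm (1 + exp w) ^ 2 \<ge> 1 + (exp x)\<^sup>2" .
    have "1 \<le> (exp x)\<^sup>2" using x by (simp add: one_le_power)
    with * have "norm (1 + exp w) ^ 2 \<ge> (4/3)\<^sup>2" by (simp add: power2_eq_square)
    then have "norm (1 + exp w) \<ge> 4/3" by (rule power2_le_imp_le) simp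
    moreover have "9/16 * (exp x)\<^sup>2 \<le> norm (1 + exp w) ^ 2"
      using * zero_le_power2[of "exp x"] by linarith
    then have "(3/4 * exp x)\<^sup>2 \<le> norm (1 + exp w) ^ 2"
      by (simp add: power_mult_distrib power_divide)
    then have "3/4 * exp x \<le> norm (1 + exp w)" by (rule power2_le_imp_le) simp
    ultimately show ?thesis by simp
  next
    case False
    then have "x \<ge> 3/2" using assms pi_gt3 by (simp add: x_def)
    then have 4: "exp x \<ge> 4" by (rule exp_ge_4)
    have "norm (1 + exp w) \<ge> norm (exp w) - norm (1::complex)"
      by (metis add.commute norm_diff_ineq)
    then have "norm (1 + exp w) \<ge> exp x - 1" by (simp add: x_def)
    with 4 show ?thesis by simp
  qed
  then have *: "norm (1 + exp w) \<ge> 4/3" "norm (1 + exp w) \<ge> 3/4 * exp x" by auto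
  from *(1) show nz: "1 + exp w \<noteq> 0" by auto
  from * nz have pos: "norm (1 + exp w) > 0" by simp
  show "norm (fermi w) \<le> 3/4"
    using *(1) pos by (simp add: fermi_def norm_divide field_simps)
  show "norm (fermi w) \<le> 4/3 * exp (- Re w)"
    using *(2) pos by (simp add: fermi_def norm_divide exp_minus field_simps x_def)
qed

text \<open>The polynomial has no constant term. One factor \<open>fermi w\<close> supplies the
  exponential decay, and the cofactor is bounded through \<open>norm (fermi w) \<le> 3/4\<close> by
  3075, whence \<open>4100 = 4/3 * 3075\<close>.\<close>

lemma norm_fermi_poly_6:
  assumes "\<bar>Im w\<bar> \<le> Re w"
  shows "norm (poly (fermi_poly 6) (fermi w)) \<le> 4100 * exp (- Re w)"
proof -
  define x where "x = fermi w"
  define r where "r = norm x"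
  have r: "0 \<le> r" "r \<le> 3/4" "r \<le> 4/3 * exp (- Re w)"
    using norm_fermi_sector[OF assms] by (simp_all add: x_def r_def)
  have p: "r ^ k \<le> (3/4) ^ k" for k using r by (intro power_mono) auto
  have "norm (poly (fermi_poly 6) x)
      = norm (x * (1 - 63 * x + 602 * x^2 - 2100 * x^3 + 3360 * x^4 - 2520 * x^5 + 720 * x^6))"
    by (simp add: fermi_polys algebra_simps power_numeral_reduce)
  also have "\<dots> \<le> r * (1 + 63 * r + 602 * r^2 + 2100 * r^3 + 3360 * r^4 + 2520 * r^5 + 720 * r^6)"
    unfolding norm_mult r_def
    by (intro mult_left_mono norm_ge_zero
          order.trans[OF norm_triangle_ineq] order.trans[OF norm_triangle_ineq4] add_mono)
       (auto simp: norm_mult norm_power)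
  also have "\<dots> \<le> r * (1 + 63 * (3/4)^1 + 602 * (3/4)^2 + 2100 * (3/4)^3 + 3360 * (3/4)^4
      + 2520 * (3/4)^5 + 720 * (3/4)^6)"
    using p[of 1] by (intro mult_left_mono add_mono p r) auto
  also have "\<dots> \<le> r * 3075"
    using r(1) by (intro mult_left_mono) (auto simp: power_numeral_reduce)
  also have "\<dots> \<le> (4/3 * exp (- Re w)) * 3075" using r by (intro mult_right_mono) auto
  finally show ?thesis by (simp add: x_def)
qed

text \<open>
  A convex neighbourhood of the sector \<open>|Im w| \<le> Re w\<close>, including its apex, that avoids the poles of \<^const>\<open>fermi\<close>.
\<close>

definition fermi_domain :: "complex set" where
  "fermi_domain = {w. \<bar>Im w\<bar> < Re w + 1}"

lemma fermi_domain_alt: "fermi_domain = {w. Im w - Re w < 1} \<inter> {w. Im w + Re w > -1}"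
  by (auto simp: fermi_domain_def)

lemma open_fermi_domain: "open fermi_domain"
  unfolding fermi_domain_alt by (intro open_Int open_Collect_less continuous_intros)

lemma convex_fermi_domain: "convex fermi_domain"
proof -
  have "{w. Im w - Re w < 1} = {w. Complex (-1) 1 \<bullet> w < 1}"
    "{w. Im w + Re w > -1} = {w. Complex 1 1 \<bullet> w > -1}"
    by (auto simp: inner_complex_def)
  then show ?thesis
    unfolding fermi_domain_alt by (metis convex_Int convex_halfspace_lt convex_halfspace_gt)
qed

text \<open>Keeps the principal logarithm away from its branch cut. For \<open>Re w > 0\<close> the
  exponential has norm below 1; otherwise the domain forces
  \<open>\<bar>Im w\<bar> < 1 < pi / 2\<close>, where the cosine is positive. Either way the real
  part is positive.\<close>

lemma one_plus_exp_minus_not_nonpos: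
  assumes "w \<in> fermi_domain"
  shows "1 + exp (- w) \<notin> \<real>\<^sub>\<le>\<^sub>0"
proof
  assume *: "1 + exp (- w) \<in> \<real>\<^sub>\<le>\<^sub>0"
  then have re: "1 + exp (- Re w) * cos (Im w) \<le> 0"
    by (auto simp: complex_nonpos_Reals_iff Re_exp)
  show False
  proof (cases "Re w > 0")
    case True
    then have "exp (- Re w) < 1" by simp
    moreover have "exp (- Re w) * cos (Im w) \<ge> exp (- Re w) * (-1)"
      by (intro mult_left_mono) auto
    ultimately show False using re by linarith
  next
    case False
    then have "\<bar>Im w\<bar> < 1" using assms by (simp add: fermi_domain_def)
    then have "cos (Im w) > 0" using pi_gt3 by (intro cos_gt_zero_pi) auto
    then have "exp (- Re w) * cos (Im w) > 0" by simp
    then show False using re by simp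
  qed
qed

lemma has_field_derivative_Ln_one_plus_exp_minus:
  assumes "w \<in> fermi_domain"
  shows "((\<lambda>w. Ln (1 + exp (- w))) has_field_derivative (- fermi w)) (at w)"
proof -
  have nz: "1 + exp (-w) \<noteq> 0"
    using one_plus_exp_minus_not_nonpos[OF assms] by auto
  then have "exp w * (1 + exp (- w)) \<noteq> 0" by simp
  moreover have "exp w * (1 + exp (-w)) = 1 + exp w" by (simp add: algebra_simps flip: exp_add)
  ultimately have nz': "1 + exp w \<noteq> 0" by simp
  show ?thesis
    using one_plus_exp_minus_not_nonpos[OF assms] nz nz'
    by (auto intro!: derivative_eq_intros simp: fermi_def exp_minus field_simps)
qed

section \<open>The dilogarithm as a second antiderivative\<close>

text \<open>From the Basel sum: the terms with even denominators carry a quarter of it, and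
  reversing their sign subtracts them twice. The term at \<open>n = 0\<close> is 0 because division
  by zero yields 0, so the same coefficients can serve in a power series.\<close>

lemma alternating_inverse_squares_sums:
  "(\<lambda>n. - ((-1) ^ n / (of_nat n)\<^sup>2) :: complex) sums of_real (pi\<^sup>2 / 12)"
proof -
  define a :: "nat \<Rightarrow> real" where "a = (\<lambda>n. 1 / (real n + 1)\<^sup>2)"
  define b :: "nat \<Rightarrow> real" where "b = (\<lambda>n. (-1) ^ n / (real n + 1)\<^sup>2)"
  have a: "a sums (pi\<^sup>2 / 6)"
    using inverse_squares_sums by (simp add: a_def add_ac)
  have "summable b"
    by (rule summable_comparison_test'[OF sums_summable[OF a], of 0])
       (simp add: a_def b_def norm_divide norm_power)
  then have b: "b sums suminf b" by (rule summable_sums)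
  have eq: "(\<Sum>n<2*N. b n) = (\<Sum>n<2*N. a n) - (\<Sum>n<N. a n) / 2" for N
  proof (induction N)
    case (Suc N)
    have "real (Suc (2 * N)) + 1 = 2 * (real N + 1)" by simp
    then have "a (Suc (2 * N)) = a N / 4" by (simp only: a_def power_mult_distrib) simp
    moreover have "b (2 * N) = a (2 * N)" "b (Suc (2 * N)) = - a (Suc (2 * N))"
      by (simp_all add: a_def b_def)
    ultimately have "b (2 * N) + b (Suc (2 * N)) = a (2 * N) + a (Suc (2 * N)) - a N / 2"
      by simp
    then show ?case using Suc by (simp add: field_simps)
  qed simp
  have "(\<lambda>N. \<Sum>n<2*N. b n) \<longlonglongrightarrow> suminf b"
    using filterlim_compose[OF b[unfolded sums_def], of "\<lambda>N. 2 * N" sequentially]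
    by (simp add: mult_nat_left_at_top)
  moreover have "(\<lambda>N. (\<Sum>n<2*N. a n) - (\<Sum>n<N. a n) / 2) \<longlonglongrightarrow> pi\<^sup>2 / 6 - (pi\<^sup>2 / 6) / 2"
    using filterlim_compose[OF a[unfolded sums_def], of "\<lambda>N. 2 * N" sequentially] a[unfolded sums_def]
    by (intro tendsto_intros) (simp_all add: mult_nat_left_at_top)
  ultimately have "suminf b = pi\<^sup>2 / 6 - (pi\<^sup>2 / 6) / 2"
    unfolding eq by (rule LIMSEQ_unique)
  with b have "b sums (pi\<^sup>2 / 12)" by simp
  then have "(\<lambda>n. complex_of_real (b n)) sums of_real (pi\<^sup>2 / 12)"
    by (rule sums_of_real)
  also have "(\<lambda>n. complex_of_real (b n)) = (\<lambda>n. - ((-1) ^ Suc n / (of_nat (Suc n))\<^sup>2))"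
    by (auto simp: b_def fun_eq_iff add_ac)
  finally show ?thesis
    by (subst (asm) sums_Suc_iff) simp
qed

lemma exp_ray_tendsto:
  assumes "Re u > 0"
  shows "(\<lambda>m. exp (- (of_nat m * u))) \<longlonglongrightarrow> 0"
proof -
  have "norm (exp (- u)) < 1" using assms by simp
  then have "(\<lambda>m. exp (- u) ^ m) \<longlonglongrightarrow> 0" by (rule LIMSEQ_power_zero)
  then show ?thesis by (simp flip: exp_of_nat_mult)
qed

text \<open>For \<open>Re w > 0\<close> the function is the dilogarithm
  \<open>Li_2(- exp (- w))\<close>. Its power series does not give differentiability at
  \<open>w = 0\<close>, which lies on the circle of convergence, so \<open>H\<close> is constructed
  as a primitive on \<open>fermi_domain\<close>; the series only fixes the constant of integration
  and the limit at infinity.\<close>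

lemma fermi_antiderivative2:
  obtains H where "\<And>w. w \<in> fermi_domain \<Longrightarrow> (H has_field_derivative Ln (1 + exp (- w))) (at w)"
    and "H 0 = - of_real (pi\<^sup>2 / 12)"
    and "\<And>u. Re u > 0 \<Longrightarrow> \<bar>Im u\<bar> \<le> Re u \<Longrightarrow> (\<lambda>m. H (of_nat m * u)) \<longlonglongrightarrow> 0"
proof -
  have "(\<lambda>w. Ln (1 + exp (- w))) holomorphic_on fermi_domain"
    unfolding holomorphic_on_def field_differentiable_def
    by (blast intro: has_field_derivative_at_within has_field_derivative_Ln_one_plus_exp_minus)
  then obtain g where g: "\<And>w. w \<in> fermi_domain \<Longrightarrow>
      (g has_field_derivative Ln (1 + exp (- w))) (at w within fermi_domain)"
    by (rule holomorphic_convex_primitive'[OF convex_fermi_domain open_fermi_domain]) blast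
  define H where "H = (\<lambda>w. g w - g 0 - of_real (pi\<^sup>2 / 12))"
  have H: "(H has_field_derivative Ln (1 + exp (- w))) (at w)" if "w \<in> fermi_domain" for w
  proof -
    have "(g has_field_derivative Ln (1 + exp (- w))) (at w)"
      using g[OF that] by (simp only: at_within_open[OF that open_fermi_domain])
    then have "(H has_field_derivative Ln (1 + exp (- w)) - 0 - 0) (at w)"
      unfolding H_def by (intro derivative_intros)
    then show ?thesis by simp
  qed
  define c :: "nat \<Rightarrow> complex" where "c = (\<lambda>n. - ((-1) ^ n / (of_nat n)\<^sup>2))"
  \<comment> \<open>This is \<open>- Li_2(- x)\<close>; the aim is
    \<open>H w = - P (exp (- w))\<close> in the right half of the domain.\<close>
  define P where "P = (\<lambda>x. \<Sum>n. c n * x ^ n)"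
  have P1: "P 1 = of_real (pi\<^sup>2 / 12)"
    using sums_unique[OF alternating_inverse_squares_sums] by (simp add: P_def c_def)
  \<comment> \<open>Continuity on the closed disc is what allows passing to the boundary point
    \<open>x = 1\<close>, that is to \<open>w = 0\<close>.\<close>
  have cont: "continuous_on (cball 0 1) P"
  proof (rule uniform_limit_theorem)
    have "summable (\<lambda>n. 1 / (real n)\<^sup>2)"
      using inverse_power_summable[of 2, where 'a = real] by (simp add: inverse_eq_divide)
    then show "uniform_limit (cball 0 1) (\<lambda>N x. \<Sum>n<N. c n * x ^ n) P sequentially"
      unfolding P_def
      by (intro Weierstrass_m_test[where M = "\<lambda>n. 1 / (real n)\<^sup>2"])
         (auto simp: c_def norm_mult norm_divide norm_power intro!: divide_right_mono power_le_one)
  qed (auto intro!: always_eventually continuous_intros)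
  have P': "(P has_field_derivative (\<Sum>n. diffs c n * x ^ n)) (at x)"
    "x * (\<Sum>n. diffs c n * x ^ n) = Ln (1 + x)" if "norm x < 1" for x
  proof -
    have sm: "summable (\<lambda>n. c n * x ^ n)" if "norm x < 1" for x
    proof (rule summable_comparison_test'[where N = 1])
      show "summable (\<lambda>n. norm x ^ n)" using that by (intro summable_geometric) auto
      fix n :: nat assume "n \<ge> 1"
      then have "1 / (real n)\<^sup>2 \<le> 1" by (simp add: field_simps one_le_power)
      then show "norm (c n * x ^ n) \<le> norm x ^ n"
        using mult_right_mono[of "1 / (real n)\<^sup>2" 1 "norm x ^ n"]
        by (simp add: c_def norm_mult norm_divide norm_power)
    qed
    show "(P has_field_derivative (\<Sum>n. diffs c n * x ^ n)) (at x)"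
      unfolding P_def using sm that by (intro termdiffs_strong'[where K = 1]) auto
    have "summable (\<lambda>n. diffs c n * x ^ n)"
      using sm that by (intro termdiff_converges[where K = 1]) auto
    then have "(\<lambda>n. x * (diffs c n * x ^ n)) sums (x * (\<Sum>n. diffs c n * x ^ n))"
      by (intro sums_mult summable_sums)
    moreover have "(\<lambda>n. x * (diffs c n * x ^ n)) = (\<lambda>n. - ((- x) ^ Suc n) / of_nat (Suc n))"
    proof
      fix n
      have "of_nat n + (1::complex) \<noteq> 0" by (metis of_nat_Suc of_nat_neq_0 add.commute)
      then show "x * (diffs c n * x ^ n) = - ((- x) ^ Suc n) / of_nat (Suc n)"
        by (simp add: diffs_def c_def power2_eq_square add_ac power_minus[of x n])
    qed
    moreover have "(\<lambda>n. - ((- x) ^ Suc n) / of_nat (Suc n)) sums Ln (1 + x)"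
      using Ln_series'[OF that] by (subst sums_Suc_iff) simp
    ultimately show "x * (\<Sum>n. diffs c n * x ^ n) = Ln (1 + x)"
      using sums_unique2 by metis
  qed
  define U where "U = fermi_domain \<inter> {w. Re w > 0}"
  have U: "open U" "connected U"
    unfolding U_def
    by (intro open_Int open_fermi_domain open_halfspace_Re_gt)
       (intro convex_connected convex_Int convex_fermi_domain convex_halfspace_Re_gt)
  have "(\<lambda>w. H w + P (exp (- w))) constant_on U"
  proof (rule has_field_derivative_0_imp_constant_on)
    fix w assume w: "w \<in> U"
    then have x: "norm (exp (- w)) < 1" by (simp add: U_def)
    have "((\<lambda>w. P (exp (- w))) has_field_derivative
        (\<Sum>n. diffs c n * exp (- w) ^ n) * (- exp (- w))) (at w)"
      by (rule DERIV_chain2[where f = P and g = "\<lambda>w. exp (- w)" and x = w, OF P'(1)[OF x]]) (auto intro!: derivative_eq_intros)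
    then have "((\<lambda>w. H w + P (exp (- w))) has_field_derivative
        Ln (1 + exp (- w)) + (\<Sum>n. diffs c n * exp (- w) ^ n) * (- exp (- w))) (at w)"
      using H w by (intro derivative_intros) (auto simp: U_def)
    then show "((\<lambda>w. H w + P (exp (- w))) has_field_derivative 0) (at w)"
      using P'(2)[OF x] by (simp add: mult.commute)
  qed (use U in auto)
  then obtain k where k: "\<And>w. w \<in> U \<Longrightarrow> H w + P (exp (- w)) = k"
    by (auto simp: constant_on_def)
  \<comment> \<open>The apex 0 is not in \<open>U\<close>, so the constant is found by letting
    \<open>w\<close> tend to 0 along the positive reals \<open>1 / (n + 1)\<close>.\<close>
  have "k = H 0 + P 1"
  proof (rule LIMSEQ_unique)
    let ?w = "\<lambda>n. complex_of_real (inverse (real (Suc n)))"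
    have "complex_of_real s \<in> U" if "s > 0" for s using that by (simp add: U_def fermi_domain_def)
    then have "?w n \<in> U" for n by (metis inverse_positive_iff_positive of_nat_0_less_iff zero_less_Suc)
    then show "(\<lambda>n. H (?w n) + P (exp (- ?w n))) \<longlonglongrightarrow> k" using k by simp
    have w: "?w \<longlonglongrightarrow> 0"
      using tendsto_of_real[OF LIMSEQ_inverse_real_of_nat, where 'a = complex] by simp
    have "isCont H 0" using H[of 0] DERIV_isCont by (simp add: fermi_domain_def)
    then have "(\<lambda>n. H (?w n)) \<longlonglongrightarrow> H 0"
      using w by (rule isCont_tendsto_compose)
    moreover have "(\<lambda>n. P (exp (- ?w n))) \<longlonglongrightarrow> P 1"
    proof (rule continuous_on_tendsto_compose[OF cont])
      show "(\<lambda>n. exp (- ?w n)) \<longlonglongrightarrow> 1"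
        using tendsto_exp[OF tendsto_minus[OF w]] by simp
    qed auto
    ultimately show "(\<lambda>n. H (?w n) + P (exp (- ?w n))) \<longlonglongrightarrow> H 0 + P 1"
      by (rule tendsto_add)
  qed
  then have k0: "k = 0" using P1 by (simp add: H_def)
  have lim: "(\<lambda>m. H (of_nat m * u)) \<longlonglongrightarrow> 0" if u: "Re u > 0" "\<bar>Im u\<bar> \<le> Re u" for u
  proof (rule Lim_transform_eventually)
    have "isCont P 0" using P'(1)[of 0] DERIV_isCont by auto
    then have "(\<lambda>m. P (exp (- (of_nat m * u)))) \<longlonglongrightarrow> P 0"
      by (rule isCont_tendsto_compose[OF _ exp_ray_tendsto[OF u(1)]])
    moreover have "P 0 = 0" unfolding P_def powser_zero by (simp add: c_def)
    ultimately have "(\<lambda>m. P (exp (- (of_nat m * u)))) \<longlonglongrightarrow> 0" by simp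
    from tendsto_minus[OF this] show "(\<lambda>m. - P (exp (- (of_nat m * u)))) \<longlonglongrightarrow> 0" by simp
    show "\<forall>\<^sub>F m in sequentially. - P (exp (- (of_nat m * u))) = H (of_nat m * u)"
      using eventually_gt_at_top[of 0]
    proof eventually_elim
      case (elim m)
      have "\<bar>real m * Im u\<bar> \<le> real m * Re u"
        using u by (simp add: abs_mult mult_left_mono)
      then have "of_nat m * u \<in> U" using elim u by (simp add: U_def fermi_domain_def)
      then show ?case using k k0 by (simp add: add_eq_0_iff)
    qed
  qed
  show ?thesis using that[of H] H lim by (simp add: H_def)
qed

subsection \<open>Asymptotics of the logarithm of the product and of the Lambert series\<close>

lemma fermi_0 [simp]: "fermi 0 = 1/2" by (simp add: fermi_def)

lemma Ln_2: "Ln 2 = of_real (ln 2)"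
  using Ln_of_real[of 2] by simp

lemma ray_sector:
  assumes "\<bar>Im u\<bar> \<le> Re u" "x \<ge> 0"
  shows "\<bar>Im (of_real x * u)\<bar> \<le> Re (of_real x * u)" "of_real x * u \<in> fermi_domain"
  using mult_left_mono[OF assms] by (auto simp: fermi_domain_def abs_mult assms)

lemma Ln_ray_tendsto:
  assumes "Re u > 0"
  shows "(\<lambda>m. Ln (1 + exp (- (of_nat m * u)))) \<longlonglongrightarrow> 0"
proof -
  have "(\<lambda>m. Ln (1 + exp (- (of_nat m * u)))) \<longlonglongrightarrow> Ln (1 + 0)"
    by (intro tendsto_intros exp_ray_tendsto assms) auto
  then show ?thesis by simp
qed

lemma fermi_poly_ray_tendsto:
  assumes "\<bar>Im u\<bar> \<le> Re u" "Re u > 0"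
  shows "(\<lambda>m. poly (fermi_poly k) (fermi (of_nat m * u))) \<longlonglongrightarrow> 0"
proof -
  have "(\<lambda>m. norm (exp (- (of_nat m * u)))) \<longlonglongrightarrow> 0"
    using tendsto_norm[OF exp_ray_tendsto[OF assms(2)]] by simp
  then have lim: "(\<lambda>m. 4/3 * norm (exp (- (of_nat m * u)))) \<longlonglongrightarrow> 0"
    by (rule tendsto_mult_right_zero)
  have "norm (fermi (of_nat m * u)) \<le> norm (4/3 * norm (exp (- (of_nat m * u)))) * 1" for m
    using norm_fermi_sector(2)[of "of_nat m * u"] ray_sector(1)[OF assms(1), of "real m"] by simp
  then have "(\<lambda>m. fermi (of_nat m * u)) \<longlonglongrightarrow> 0"
    by (intro tendsto_0_le[OF lim] always_eventually allI)
  then have "(\<lambda>m. poly (fermi_poly k) (fermi (of_nat m * u))) \<longlonglongrightarrow> poly (fermi_poly k) 0"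
    by (intro tendsto_poly)
  then show ?thesis by simp
qed

text \<open>Allows one factor \<open>norm u\<close> of the remainder to absorb the geometric series.
  In the sector \<open>norm u\<close> is at most \<open>sqrt 2 * Re u\<close>, with
  \<open>sqrt 2\<close> rounded up to 36/25, and the denominator is at least
  \<open>12/13 * Re u\<close>; the quotient is 39/25.\<close>

lemma one_minus_exp_ray:
  assumes u: "\<bar>Im u\<bar> \<le> Re u" "0 < Re u" "Re u \<le> 1/12"
  shows "norm u / (1 - exp (- Re u)) \<le> 8/5"
proof -
  define c where "c = Re u"
  have c: "0 < c" "c \<le> 1/12" using u by (auto simp: c_def)
  have "norm u ^ 2 = c\<^sup>2 + (Im u)\<^sup>2" by (simp add: cmod_power2 c_def)
  also have "(Im u)\<^sup>2 \<le> c\<^sup>2" using power_mono[OF u(1), of 2] by (simp add: c_def)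
  finally have "norm u ^ 2 \<le> 2 * c\<^sup>2" by simp
  also have "\<dots> \<le> 1296/625 * c\<^sup>2" by (intro mult_right_mono) auto
  also have "\<dots> = (36/25 * c) ^ 2" by (simp add: power_mult_distrib power_divide)
  finally have "norm u ^ 2 \<le> (36/25 * c) ^ 2" .
  then have n: "norm u \<le> 36/25 * c" by (rule power2_le_imp_le) (use c in auto)
  have "exp (- c) \<le> 1 / (1 + c)"
    using exp_ge_add_one_self[of c] c by (simp add: exp_minus field_simps)
  then have "1 - exp (- c) \<ge> c / (1 + c)" using c by (simp add: field_simps)
  also have "c / (1 + c) \<ge> c / (13/12)" using c by (intro divide_left_mono) auto
  finally have e: "1 - exp (- c) \<ge> 12/13 * c" by simp
  have "norm u / (1 - exp (- c)) \<le> (36/25 * c) / (12/13 * c)"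
    using n e c by (intro frac_le) auto
  also have "\<dots> \<le> 8/5" using c by simp
  finally show ?thesis by (simp add: c_def)
qed

text \<open>Each bound is the sum of the absolute values of the coefficients of the polynomial, as
  all powers of \<open>a\<close> lie between 0 and 1.\<close>

lemma bernoulli_coeff_bounds:
  assumes "0 \<le> a" "a \<le> 1"
  shows "\<bar>bernoulli_coeff 1 a\<bar> \<le> 3/2" "\<bar>bernoulli_coeff 2 a\<bar> \<le> 13/12"
    "\<bar>bernoulli_coeff 3 a\<bar> \<le> 6/12" "\<bar>bernoulli_coeff 4 a\<bar> \<le> 121/720"
    "\<bar>bernoulli_coeff 5 a\<bar> \<le> 32/720" "\<bar>bernoulli_coeff 6 a\<bar> \<le> 295/30240"
proof -
  have p: "0 \<le> a ^ k" "a ^ k \<le> 1" for k using assms by (auto intro: power_le_one)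
  note q = p[of 2] p[of 3] p[of 4] p[of 5] p[of 6]
  show "\<bar>bernoulli_coeff 1 a\<bar> \<le> 3/2" "\<bar>bernoulli_coeff 2 a\<bar> \<le> 13/12"
    "\<bar>bernoulli_coeff 3 a\<bar> \<le> 6/12" "\<bar>bernoulli_coeff 4 a\<bar> \<le> 121/720"
    "\<bar>bernoulli_coeff 5 a\<bar> \<le> 32/720" "\<bar>bernoulli_coeff 6 a\<bar> \<le> 295/30240"
    unfolding bernoulli_coeffs by (use q assms in argo)+
qed

lemma em_const_6:
  assumes "0 \<le> a" "a \<le> 1"
  shows "em_const 6 a \<le> 3/10"
  using bernoulli_coeff_bounds[OF assms] bernoulli_coeffs(1)[of a]
  by (simp add: em_const_def atMost_nat_numeral fact_numeral)

lemma em_const_7: "em_const 7 1 \<le> 1/100"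
  by (simp add: em_const_def atMost_nat_numeral fact_numeral bernoulli_coeffs bernoulli_coeffs(2)[simplified])

text \<open>Euler--Maclaurin with \<open>N = 6\<close>, starting from the primitive
  \<open>- Ln (1 + exp (- w))\<close>. The remainder contributes
  \<open>4100 * (8/5) * (3/10) = 1968\<close> to the constant.\<close>

lemma fermi_sum_asymp:
  assumes u: "\<bar>Im u\<bar> \<le> Re u" "0 < Re u" "Re u \<le> 1/12" and a: "0 \<le> a" "a \<le> 1"
  obtains S where "(\<lambda>m. fermi ((of_nat m + of_real a) * u)) sums S"
    and "norm (S - (of_real (ln 2) / u - of_real (bernoulli_coeff 1 a) / 2
           + of_real (bernoulli_coeff 2 a) * u / 4 - of_real (bernoulli_coeff 4 a) * u ^ 3 / 8))
         \<le> 2000 * norm u ^ 5"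
proof -
  define f :: "nat \<Rightarrow> complex \<Rightarrow> complex" where
    "f = (\<lambda>j w. case j of 0 \<Rightarrow> - Ln (1 + exp (- w)) | Suc k \<Rightarrow> poly (fermi_poly k) (fermi w))"
  have u0: "u \<noteq> 0" using u by auto
  obtain S where S: "(\<lambda>m. f 1 ((of_nat m + of_real a) * u)) sums S"
    and bd: "norm (S + (\<Sum>j\<le>6. bernoulli_coeff j a * u ^ j * f j 0) / u)
      \<le> 4100 * norm u ^ 6 / (1 - exp (- Re u)) * em_const 6 a"
  proof (rule euler_maclaurin_ray[where f = f and a = a and N = 6 and c = "Re u" and u = u and K = 4100])
    fix j x assume x: "(x::real) \<ge> 0"
    note sec = ray_sector[OF u(1) x]
    show "(f j has_field_derivative f (Suc j) (of_real x * u)) (at (of_real x * u))"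
    proof (cases j)
      case 0
      then show ?thesis
        using DERIV_minus[OF has_field_derivative_Ln_one_plus_exp_minus[OF sec(2)]]
        by (simp add: f_def)
    next
      case (Suc k)
      then show ?thesis
        using has_field_derivative_fermi_poly[OF norm_fermi_sector(3)[OF sec(1)], of k]
        by (simp add: f_def)
    qed
  next
    fix x :: real assume "x \<ge> 0"
    then show "norm (f (Suc 6) (of_real x * u)) \<le> 4100 * exp (- Re u * x)"
      using norm_fermi_poly_6[OF ray_sector(1)[OF u(1)], of x] by (simp add: f_def mult.commute)
  next
    fix j
    show "(\<lambda>m. f j (of_nat m * u)) \<longlonglongrightarrow> 0"
      using tendsto_minus[OF Ln_ray_tendsto[OF u(2)]] fermi_poly_ray_tendsto[OF u(1,2)]
      by (cases j) (auto simp: f_def)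
  qed (use a u u0 in auto)
  define A where "A = of_real (ln 2) / u - of_real (bernoulli_coeff 1 a) / 2
           + of_real (bernoulli_coeff 2 a) * u / 4 - of_real (bernoulli_coeff 4 a) * u ^ 3 / 8"
  \<comment> \<open>Since \<open>fermi w - 1/2\<close> is odd, its even derivatives vanish at 0,
    which removes the terms \<open>j = 3\<close> and \<open>j = 5\<close>. The term
    \<open>j = 6\<close> already has the order of the error and joins it.\<close>
  have vals: "f 0 0 = - of_real (ln 2)" "f (Suc 0) 0 = 1/2" "f 2 0 = -1/4" "f 3 0 = 0" "f 4 0 = 1/8" "f 5 0 = 0" "f 6 0 = -1/4"
    using fermi_polys by (simp_all add: f_def Ln_2 eval_nat_numeral)
  have "(\<Sum>j\<le>6. bernoulli_coeff j a * u ^ j * f j 0) / u = - A - bernoulli_coeff 6 a * u ^ 5 / 4"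
    using u0 by (simp add: atMost_nat_numeral vals A_def bernoulli_coeffs(1) field_simps power_numeral_reduce)
  then have "S - A = (S + (\<Sum>j\<le>6. bernoulli_coeff j a * u ^ j * f j 0) / u) + bernoulli_coeff 6 a * u ^ 5 / 4"
    by simp
  also have "norm \<dots> \<le> 4100 * norm u ^ 6 / (1 - exp (- Re u)) * em_const 6 a + norm (bernoulli_coeff 6 a * u ^ 5 / 4)"
    by (intro order.trans[OF norm_triangle_ineq] add_mono bd order.refl)
  also have "4100 * norm u ^ 6 / (1 - exp (- Re u)) * em_const 6 a
      = 4100 * norm u ^ 5 * (norm u / (1 - exp (- Re u))) * em_const 6 a"
    by (simp add: power_numeral_reduce)
  also have "\<dots> \<le> 4100 * norm u ^ 5 * (8/5) * (3/10)"
    using one_minus_exp_ray[OF u] em_const_6[OF a] u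
    by (intro mult_mono) (auto simp: em_const_def intro!: divide_nonneg_nonneg sum_nonneg add_nonneg_nonneg)
  also have "norm (bernoulli_coeff 6 a * u ^ 5 / 4) \<le> norm u ^ 5 * (1/100) / 4"
    using mult_right_mono[OF order.trans[OF bernoulli_coeff_bounds(6)[OF a]], of "1/100" "norm u ^ 5"]
    by (simp add: norm_mult norm_power norm_divide)
  finally have "norm (S - A) \<le> 4100 * norm u ^ 5 * (8/5) * (3/10) + norm u ^ 5 * (1/100) / 4" by simp
  also have "\<dots> = 787201/400 * norm u ^ 5" by simp
  also have "\<dots> \<le> 2000 * norm u ^ 5" by (intro mult_right_mono) auto
  finally have "norm (S - A) \<le> 2000 * norm u ^ 5" .
  with S show ?thesis using that by (simp add: f_def A_def)
qed

text \<open>The same formula one antiderivative higher, with \<open>a = 1\<close> and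
  \<open>N = 7\<close>. The terms \<open>j = 3, 5, 7\<close> vanish because
  \<open>bernoulli_coeff j 1 = 0\<close>, and \<open>j = 4, 6\<close> because the even derivatives
  of \<open>fermi\<close> of order 2 and 4 vanish at 0; only \<open>j \<le> 2\<close>
  remains.\<close>

lemma Ln_euler_sum_asymp:
  assumes u: "\<bar>Im u\<bar> \<le> Re u" "0 < Re u" "Re u \<le> 1/12"
  obtains S where "(\<lambda>m. Ln (1 + exp (- (of_nat (Suc m) * u)))) sums S"
    and "norm (S - (of_real (pi\<^sup>2) / (12 * u) - of_real (ln 2) / 2 + u / 24)) \<le> 100 * norm u ^ 6"
proof -
  obtain H where H: "\<And>w. w \<in> fermi_domain \<Longrightarrow> (H has_field_derivative Ln (1 + exp (- w))) (at w)"
    "H 0 = - of_real (pi\<^sup>2 / 12)" "(\<lambda>m. H (of_nat m * u)) \<longlonglongrightarrow> 0"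
    using fermi_antiderivative2 u by metis
  define f :: "nat \<Rightarrow> complex \<Rightarrow> complex" where
    "f = (\<lambda>j w. case j of 0 \<Rightarrow> H w | Suc 0 \<Rightarrow> Ln (1 + exp (- w)) | Suc (Suc k) \<Rightarrow> - poly (fermi_poly k) (fermi w))"
  have u0: "u \<noteq> 0" using u by auto
  obtain S where S: "(\<lambda>m. f 1 ((of_nat m + of_real 1) * u)) sums S"
    and bd: "norm (S + (\<Sum>j\<le>7. bernoulli_coeff j 1 * u ^ j * f j 0) / u)
      \<le> 4100 * norm u ^ 7 / (1 - exp (- Re u)) * em_const 7 1"
  proof (rule euler_maclaurin_ray[where f = f and a = 1 and N = 7 and c = "Re u" and u = u and K = 4100])
    fix j x assume x: "(x::real) \<ge> 0"
    note sec = ray_sector[OF u(1) x]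
    consider "j = 0" | "j = 1" | k where "j = Suc (Suc k)" by (metis One_nat_def not0_implies_Suc)
    then show "(f j has_field_derivative f (Suc j) (of_real x * u)) (at (of_real x * u))"
    proof cases
      case 1
      then show ?thesis using H(1)[OF sec(2)] by (simp add: f_def)
    next
      case 2
      then show ?thesis
        using has_field_derivative_Ln_one_plus_exp_minus[OF sec(2)]
        by (simp add: f_def)
    next
      case 3
      then show ?thesis
        using DERIV_minus[OF has_field_derivative_fermi_poly[OF norm_fermi_sector(3)[OF sec(1)], of k]]
        by (simp add: f_def)
    qed
  next
    fix x :: real assume "x \<ge> 0"
    then show "norm (f (Suc 7) (of_real x * u)) \<le> 4100 * exp (- Re u * x)"
      using norm_fermi_poly_6[OF ray_sector(1)[OF u(1)], of x]
      by (simp add: f_def mult.commute eval_nat_numeral del: fermi_poly.simps)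
  next
    fix j
    show "(\<lambda>m. f j (of_nat m * u)) \<longlonglongrightarrow> 0"
    proof -
      consider "j = 0" | "j = 1" | k where "j = Suc (Suc k)" by (metis One_nat_def not0_implies_Suc)
      then show ?thesis
        using Ln_ray_tendsto[OF u(2)] tendsto_minus[OF fermi_poly_ray_tendsto[OF u(1,2)]] H(3)
        by cases (simp_all add: f_def)
    qed
  qed (use u u0 in auto)
  define A where "A = of_real (pi\<^sup>2) / (12 * u) - of_real (ln 2) / 2 + u / 24"
  have vals: "f 0 0 = - of_real (pi\<^sup>2 / 12)" "f (Suc 0) 0 = of_real (ln 2)" "f 2 0 = -1/2" "f 4 0 = 0" "f 6 0 = 0"
    using fermi_polys H(2) by (simp_all add: f_def Ln_2 eval_nat_numeral)
  have "(\<Sum>j\<le>7. bernoulli_coeff j 1 * u ^ j * f j 0) / u = - A"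
    using u0 by (simp add: atMost_nat_numeral vals A_def bernoulli_coeffs bernoulli_coeffs(2)[simplified]
        field_simps power_numeral_reduce)
  then have "norm (S - A) \<le> 4100 * norm u ^ 7 / (1 - exp (- Re u)) * em_const 7 1"
    using bd by simp
  also have "\<dots> = 4100 * norm u ^ 6 * (norm u / (1 - exp (- Re u))) * em_const 7 1"
    by (simp add: power_numeral_reduce)
  also have "\<dots> \<le> 4100 * norm u ^ 6 * (8/5) * (1/100)"
    using one_minus_exp_ray[OF u] em_const_7 u
    by (intro mult_mono) (auto simp: em_const_def intro!: divide_nonneg_nonneg sum_nonneg add_nonneg_nonneg)
  also have "\<dots> = 328/5 * norm u ^ 6" by simp
  also have "\<dots> \<le> 100 * norm u ^ 6" by (intro mult_right_mono) auto
  finally show ?thesis using that S by (simp add: f_def A_def add.commute)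
qed

subsection \<open>Bounds away from the positive real axis\<close>

text \<open>A sum of principal logarithms of the factors, which need not be the principal logarithm
  of the product.\<close>

definition euler_log :: "complex \<Rightarrow> complex" where
  "euler_log z = (\<Sum>m. Ln (1 + exp (- (of_nat (Suc m) * z))))"

lemma norm_exp_minus_multiple:
  assumes "Re z > 0" "k > 0"
  shows "norm (exp (- z) ^ k) < 1" "1 + exp (- z) ^ k \<noteq> 0"
proof -
  show *: "norm (exp (- z) ^ k) < 1"
    using assms by (simp add: norm_power power_less_one_iff)
  show "1 + exp (- z) ^ k \<noteq> 0"
  proof
    assume "1 + exp (- z) ^ k = 0"
    then have "exp (- z) ^ k = -1" by (simp add: add_eq_0_iff)
    then show False using * by simp
  qed
qed

lemma euler_log_sums:
  assumes "Re z > 0"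
  shows "(\<lambda>m. Ln (1 + exp (- (of_nat (Suc m) * z)))) sums euler_log z"
proof -
  have q: "norm (exp (- z)) < 1" using assms by simp
  have e: "exp (- (of_nat (Suc m) * z)) = exp (- z) ^ Suc m" for m
    using exp_of_nat_mult[of "Suc m" "- z"] by simp
  have "(\<lambda>m. norm (exp (- z) ^ Suc m)) \<longlonglongrightarrow> 0"
    using LIMSEQ_Suc[OF LIMSEQ_power_zero[OF q]] by (rule tendsto_norm_zero)
  then have "eventually (\<lambda>m. norm (exp (- z) ^ Suc m) < 1/2) sequentially"
    by (rule order_tendstoD) simp
  then have "eventually (\<lambda>m. norm (Ln (1 + exp (- (of_nat (Suc m) * z)))) \<le> 2 * norm (exp (- z)) ^ Suc m) sequentially"
  proof eventually_elim
    case (elim m)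
    then show ?case
      using norm_Ln_le[of "exp (- z) ^ Suc m"] unfolding e by (simp add: norm_power del: power_Suc)
  qed
  moreover have "summable (\<lambda>m. 2 * norm (exp (- z)) ^ Suc m)"
    using q by (intro summable_mult summable_ignore_initial_segment[of _ 1, simplified] summable_geometric) auto
  ultimately have "summable (\<lambda>m. Ln (1 + exp (- (of_nat (Suc m) * z))))"
    by (rule summable_comparison_test_ev)
  then show ?thesis unfolding euler_log_def by (rule summable_sums)
qed

lemma euler_prod_tendsto:
  assumes "Re z > 0"
  shows "(\<lambda>M. \<Prod>k=1..M. 1 + exp (- z) ^ k) \<longlonglongrightarrow> exp (euler_log z)"
proof -
  have "(\<Prod>k=1..M. 1 + exp (- z) ^ k) = exp (\<Sum>m<M. Ln (1 + exp (- (of_nat (Suc m) * z))))" for M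
  proof -
    have "exp (\<Sum>m<M. Ln (1 + exp (- (of_nat (Suc m) * z)))) = (\<Prod>m<M. 1 + exp (- z) ^ Suc m)"
      using norm_exp_minus_multiple(2)[OF assms] exp_of_nat_mult[of "Suc _" "- z"]
      by (simp add: exp_sum del: power_Suc of_nat_Suc)
    also have "\<dots> = (\<Prod>k=1..M. 1 + exp (- z) ^ k)"
      by (rule prod.reindex_bij_witness[of _ "\<lambda>k. k - 1" Suc]) auto
    finally show ?thesis ..
  qed
  then show ?thesis
    using tendsto_exp[OF euler_log_sums[OF assms, unfolded sums_def]] by simp
qed

section \<open>Loss of size of the product off the real axis\<close>

text \<open>With \<open>d = s * (1 - cos \<theta>)\<close> the squared norm is
  \<open>(1 + s)^2 - 2 * d\<close>. As \<open>(1 + s)^2 \<le> 4\<close>, this is at most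
  \<open>(1 + s)^2 * (1 - d / 2)\<close>, and \<open>1 - x \<le> exp (- x)\<close> finishes.\<close>

lemma norm_one_plus_le:
  fixes s \<theta> :: real
  assumes "0 \<le> s" "s \<le> 1"
  shows "norm (1 + of_real s * cis \<theta>) \<le> (1 + s) * exp (- (s * (1 - cos \<theta>)) / 4)"
proof (rule power2_le_imp_le)
  define d where "d = s * (1 - cos \<theta>)"
  have d: "d \<ge> 0" using assms by (simp add: d_def)
  have "norm (1 + of_real s * cis \<theta>) ^ 2 = (1 + s * cos \<theta>)\<^sup>2 + (s * sin \<theta>)\<^sup>2"
    by (simp add: cmod_power2)
  also have "\<dots> = (1 + s)\<^sup>2 - 2 * d"
    unfolding d_def using sin_cos_squared_add[of \<theta>] by algebra
  also have "\<dots> \<le> (1 + s)\<^sup>2 * (1 - d / 2)"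
  proof -
    have "(1 + s)\<^sup>2 \<le> 2\<^sup>2" using assms by (intro power_mono) auto
    then have "(1 + s)\<^sup>2 * d \<le> 4 * d" using d by (intro mult_right_mono) auto
    then show ?thesis by (simp add: algebra_simps)
  qed
  also have "\<dots> \<le> (1 + s)\<^sup>2 * exp (- d / 2)"
    using exp_ge_add_one_self[of "- d / 2"] by (intro mult_left_mono) auto
  also have "exp (- d / 2) = exp (- d / 4) ^ 2"
    by (simp flip: exp_double)
  finally show "norm (1 + of_real s * cis \<theta>) ^ 2 \<le> ((1 + s) * exp (- (s * (1 - cos \<theta>)) / 4)) ^ 2"
    by (simp add: d_def power_mult_distrib)
qed (use assms in auto)

lemma exp_minus_Complex_power:
  "exp (- Complex h y) ^ k = of_real (exp (- h) ^ k) * cis (- (real k * y))"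
proof -
  have "exp (- Complex h y) = of_real (exp (- h)) * cis (- y)"
    by (simp add: exp_eq_polar)
  then show ?thesis using Complex.DeMoivre[of "- y" k] by (simp add: power_mult_distrib)
qed

text \<open>The factorwise bound is multiplied over \<open>k \<le> M\<close> before \<open>M\<close>
  tends to infinity. The accumulated exponents \<open>exp (- h) ^ k * (1 - cos (k * y))\<close> are
  real parts of differences of two geometric series, which explains the closed form.\<close>

lemma norm_exp_euler_log_le:
  assumes h: "h > 0"
  shows "norm (exp (euler_log (Complex h y)))
      \<le> norm (exp (euler_log (of_real h))) * exp (- (1 / (exp h - 1) - Re (1 / (exp (Complex h y) - 1))) / 4)"
proof -
  define z where "z = Complex h y"
  have z: "Re z > 0" using h by (simp add: z_def)
  define d where "d = (\<lambda>k. exp (- h) ^ k * (1 - cos (real k * y)))"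
  have geo: "(\<lambda>k. exp (- w) ^ Suc k) sums (1 / (exp w - 1))" if "Re w > 0" for w :: complex
  proof -
    have "norm (exp (- w)) < 1" using that by simp
    then have "(\<lambda>k. exp (- w) * exp (- w) ^ k) sums (exp (- w) * (1 / (1 - exp (- w))))"
      by (intro sums_mult geometric_sums)
    moreover have "exp (- w) * (1 / (1 - exp (- w))) = 1 / (exp w - 1)"
      by (simp add: exp_minus field_simps)
    ultimately show ?thesis by simp
  qed
  have "(\<lambda>k. Re (exp (- of_real h) ^ Suc k - exp (- z) ^ Suc k))
      sums Re (1 / (exp (of_real h) - 1) - 1 / (exp z - 1))"
    using z h by (intro sums_Re sums_diff geo) auto
  also have "(\<lambda>k. Re (exp (- of_real h) ^ Suc k - exp (- z) ^ Suc k)) = (\<lambda>k. d (Suc k))"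
  proof
    fix k
    have "exp (- complex_of_real h) ^ Suc k = of_real (exp (- h) ^ Suc k)"
      by (simp add: exp_of_real flip: of_real_minus)
    then show "Re (exp (- of_real h) ^ Suc k - exp (- z) ^ Suc k) = d (Suc k)"
      unfolding z_def exp_minus_Complex_power d_def by (simp add: right_diff_distrib del: power_Suc of_nat_Suc)
  qed
  also have "Re (1 / (exp (of_real h) - 1) - 1 / (exp z - 1)) = 1 / (exp h - 1) - Re (1 / (exp z - 1))"
  proof -
    have "1 / (exp (complex_of_real h) - 1) = of_real (1 / (exp h - 1))"
      by (simp add: exp_of_real)
    then show ?thesis by simp
  qed
  finally have ds: "(\<lambda>k. d (Suc k)) sums (1 / (exp h - 1) - Re (1 / (exp z - 1)))" .
  have "(\<lambda>M. \<Sum>k=1..M. d k) \<longlonglongrightarrow> 1 / (exp h - 1) - Re (1 / (exp z - 1))"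
  proof -
    have "(\<Sum>k=1..M. d k) = (\<Sum>k<M. d (Suc k))" for M
      by (rule sum.reindex_bij_witness[of _ Suc "\<lambda>k. k - 1"]) auto
    then show ?thesis using ds by (simp add: sums_def)
  qed
  then have R: "(\<lambda>M. norm (\<Prod>k=1..M. 1 + exp (- complex_of_real h) ^ k) * exp (- (\<Sum>k=1..M. d k) / 4))
     \<longlonglongrightarrow> norm (exp (euler_log (of_real h))) * exp (- (1 / (exp h - 1) - Re (1 / (exp z - 1))) / 4)"
    using h by (intro tendsto_intros euler_prod_tendsto) auto
  have "norm (\<Prod>k=1..M. 1 + exp (- z) ^ k)
      \<le> norm (\<Prod>k=1..M. 1 + exp (- complex_of_real h) ^ k) * exp (- (\<Sum>k=1..M. d k) / 4)" for M
  proof -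
    have "norm (\<Prod>k=1..M. 1 + exp (- z) ^ k) = (\<Prod>k=1..M. norm (1 + exp (- z) ^ k))"
      by (simp add: prod_norm)
    also have "\<dots> \<le> (\<Prod>k=1..M. (1 + exp (- h) ^ k) * exp (- d k / 4))"
    proof (intro prod_mono conjI)
      fix k
      have "exp (- h) ^ k \<le> 1" using h by (intro power_le_one) auto
      then show "norm (1 + exp (- z) ^ k) \<le> (1 + exp (- h) ^ k) * exp (- d k / 4)"
        using norm_one_plus_le[of "exp (- h) ^ k" "- (real k * y)"]
        by (simp add: z_def exp_minus_Complex_power d_def)
    qed auto
    also have "\<dots> = (\<Prod>k=1..M. 1 + exp (- h) ^ k) * exp (- (\<Sum>k=1..M. d k) / 4)"
    proof -
      have "- (\<Sum>k=1..M. d k) / 4 = (\<Sum>k=1..M. - d k / 4)"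
        by (simp add: sum_negf sum_divide_distrib)
      then show ?thesis by (simp only: exp_sum[OF finite_atLeastAtMost] prod.distrib)
    qed
    also have "(\<Prod>k=1..M. 1 + exp (- h) ^ k) = norm (\<Prod>k=1..M. 1 + exp (- of_real h :: complex) ^ k)"
    proof -
      have "(\<Prod>k=1..M. 1 + exp (- of_real h :: complex) ^ k) = of_real (\<Prod>k=1..M. 1 + exp (- h) ^ k)"
        by (simp add: exp_of_real flip: of_real_minus)
      moreover have "(\<Prod>k=1..M. 1 + exp (- h) ^ k) \<ge> 0" by (intro prod_nonneg) auto
      ultimately show ?thesis by (simp only: norm_of_real abs_of_nonneg)
    qed
    finally show ?thesis .
  qed
  then show ?thesis
    using LIMSEQ_le[OF tendsto_norm[OF euler_prod_tendsto[OF z]] R] by (simp add: z_def)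
qed

text \<open>By monotonicity the worst case is \<open>\<bar>y\<bar> = h\<close>. There
  \<open>1 - cos h = 2 * sin (h/2)^2\<close>, and the cubic Taylor bound gives
  \<open>sin (h/2) \<ge> 23/48 * h\<close>.\<close>

lemma one_minus_cos_ge:
  fixes y h :: real
  assumes "0 \<le> h" "h \<le> 1" "h \<le> \<bar>y\<bar>" "\<bar>y\<bar> \<le> pi"
  shows "9/20 * h\<^sup>2 \<le> 1 - cos y"
proof -
  have "cos y = cos \<bar>y\<bar>" by (simp add: abs_if)
  also have "\<dots> \<le> cos h" using assms by (intro cos_monotone_0_pi_le) auto
  finally have c: "cos y \<le> cos h" .
  have "\<bar>sin (h/2) - (\<Sum>m<3. sin_coeff m * (h/2) ^ m)\<bar> \<le> inverse (fact 3) * \<bar>h/2\<bar> ^ 3"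
    by (rule Maclaurin_sin_bound)
  also have "(\<Sum>m<3. sin_coeff m * (h/2) ^ m) = h/2"
    by (simp add: sin_coeff_def numeral_3_eq_3)
  finally have "sin (h/2) \<ge> h/2 - inverse (fact 3) * \<bar>h/2\<bar> ^ 3" by linarith
  also have "inverse (fact 3) * \<bar>h/2\<bar> ^ 3 = h ^ 3 / 48"
    using assms by (simp add: fact_numeral power_divide)
  finally have "sin (h/2) \<ge> h/2 - h ^ 3 / 48" .
  moreover have "h ^ 3 \<le> h ^ 1" using assms by (intro power_decreasing) auto
  ultimately have "23/48 * h \<le> sin (h/2)" by simp
  then have "(23/48 * h)\<^sup>2 \<le> (sin (h/2))\<^sup>2" using assms by (intro power_mono) auto
  then have "529/2304 * h\<^sup>2 \<le> (sin (h/2))\<^sup>2" by (simp add: power_mult_distrib power_divide)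
  moreover have "cos h = 1 - 2 * (sin (h/2))\<^sup>2" using cos_double_sin[of "h/2"] by simp
  ultimately show ?thesis using c zero_le_power2[of h] by argo
qed

text \<open>With \<open>E\<close>, \<open>A\<close> and \<open>c\<close> as defined in the proof,
  the real part equals \<open>(A - E * c) / (A^2 + 2 * E * c)\<close>. The condition
  \<open>h \<le> \<bar>y\<bar>\<close> gives \<open>2 * E * c \<ge> A^2 / 2\<close>, so the fraction
  is at most \<open>2 / (3 * A)\<close>. What is gained is \<open>1 / (3 * A)\<close> with
  \<open>A \<le> 24/23 * h\<close>.\<close>

lemma Re_inverse_exp_minus_one_le:
  fixes h y :: real
  assumes h: "0 < h" "h \<le> 1/24" and y: "h \<le> \<bar>y\<bar>" "\<bar>y\<bar> \<le> pi"
  shows "1 / (exp h - 1) - Re (1 / (exp (Complex h y) - 1)) \<ge> 23 / (72 * h)"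
proof -
  define E A c where "E = exp h" and "A = E - 1" and "c = 1 - cos y"
  have E: "E > 1" using h by (simp add: E_def)
  then have A: "A > 0" by (simp add: A_def)
  have c: "9/20 * h\<^sup>2 \<le> c" unfolding c_def using h y by (intro one_minus_cos_ge) auto
  then have c0: "c \<ge> 0" using zero_le_power2[of h] by argo
  have "1 - h \<le> exp (- h)" using exp_ge_add_one_self[of "- h"] by simp
  then have "E * (1 - h) \<le> 1"
    using mult_left_mono[of "1 - h" "exp (- h)" E] by (simp add: E_def exp_minus)
  then have "A * (1 - h) \<le> h" by (simp add: A_def algebra_simps)
  moreover have "A * (23/24) \<le> A * (1 - h)" using h A by (intro mult_left_mono) auto
  ultimately have Ah: "A \<le> 24/23 * h" by simp
  then have "A\<^sup>2 \<le> (24/23 * h)\<^sup>2" using A by (intro power_mono) auto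
  then have "A\<^sup>2 \<le> 576/529 * h\<^sup>2" by (simp add: power_mult_distrib power_divide)
  moreover have "c \<le> E * c" using E c0 by (simp add: mult_le_cancel_right1)
  ultimately have B: "A\<^sup>2 / 2 \<le> 2 * (E * c)" using c zero_le_power2[of h] by argo
  have re: "Re (exp (Complex h y) - 1) = A - E * c"
    by (simp add: Re_exp A_def E_def c_def algebra_simps)
  have "(Re (exp (Complex h y) - 1))\<^sup>2 + (Im (exp (Complex h y) - 1))\<^sup>2
      = (E * cos y - 1)\<^sup>2 + (E * sin y)\<^sup>2"
    by (simp add: Re_exp Im_exp E_def)
  also have "\<dots> = A\<^sup>2 + 2 * (E * c)"
    unfolding A_def c_def using sin_cos_squared_add[of y] by algebra
  finally have "Re (1 / (exp (Complex h y) - 1)) = (A - E * c) / (A\<^sup>2 + 2 * (E * c))"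
    using re by (simp add: divide_inverse[of 1])
  also have "\<dots> \<le> A / (A\<^sup>2 + A\<^sup>2 / 2)"
    using A B E c0 by (intro frac_le) (auto intro: add_pos_pos)
  also have "\<dots> = 2 / (3 * A)" using A by (simp add: field_simps power2_eq_square)
  finally have "1 / A - Re (1 / (exp (Complex h y) - 1)) \<ge> 1 / A - 2 / (3 * A)" by simp
  also have "1 / A - 2 / (3 * A) = 1 / (3 * A)" using A by (simp add: field_simps)
  also have "1 / (3 * A) \<ge> 1 / (3 * (24/23 * h))"
    using A Ah h by (intro divide_left_mono) auto
  finally show ?thesis using h by (simp add: A_def E_def)
qed

text \<open>The value at \<open>y = 0\<close> is at most \<open>exp (pi^2 / (12 * h))\<close>, and
  the gain is a quarter of \<open>23 / (72 * h)\<close>. The resulting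
  \<open>(pi^2 - 23/24) / 12\<close> is just below 3/4.\<close>

lemma norm_exp_euler_log_minor:
  fixes h y :: real
  assumes h: "0 < h" "h \<le> 1/24" and y: "h \<le> \<bar>y\<bar>" "\<bar>y\<bar> \<le> pi"
  shows "norm (exp (euler_log (Complex h y))) \<le> exp (3 / (4 * h))"
proof -
  obtain S where S: "(\<lambda>m. Ln (1 + exp (- (of_nat (Suc m) * of_real h)))) sums S"
    "norm (S - (of_real (pi\<^sup>2) / (12 * of_real h) - of_real (ln 2) / 2 + of_real h / 24))
        \<le> 100 * norm (complex_of_real h) ^ 6"
    using Ln_euler_sum_asymp[of "of_real h"] h by auto
  have "S = euler_log (of_real h)"
    using sums_unique2[OF S(1) euler_log_sums] h by simp
  moreover have "of_real (pi\<^sup>2) / (12 * of_real h) - of_real (ln 2) / 2 + of_real h / 24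
      = complex_of_real (pi\<^sup>2 / (12 * h) - ln 2 / 2 + h / 24)" by simp
  ultimately have "norm (euler_log (of_real h) - of_real (pi\<^sup>2 / (12 * h) - ln 2 / 2 + h / 24)) \<le> 100 * h ^ 6"
    using S(2) h by (simp only: norm_of_real abs_of_pos)
  then have "Re (euler_log (of_real h)) - (pi\<^sup>2 / (12 * h) - ln 2 / 2 + h / 24) \<le> 100 * h ^ 6"
    by (metis Re_complex_of_real complex_Re_le_cmod minus_complex.sel(1) order_trans)
  moreover have "h ^ 6 \<le> (1/24) ^ 6" using h by (intro power_mono) auto
  \<comment> \<open>The negative constant \<open>- ln 2 / 2\<close> absorbs both
    \<open>h / 24\<close> and the error \<open>100 * h ^ 6\<close>.\<close>
  ultimately have "Re (euler_log (of_real h)) \<le> pi\<^sup>2 / (12 * h)"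
    using ln2_ge_two_thirds h by (simp add: power_numeral_reduce)
  then have 1: "norm (exp (euler_log (of_real h))) \<le> exp (pi\<^sup>2 / (12 * h))" by simp
  have "norm (exp (euler_log (Complex h y)))
      \<le> exp (pi\<^sup>2 / (12 * h)) * exp (- (23 / (72 * h)) / 4)"
    using Re_inverse_exp_minus_one_le[OF assms] 
    by (intro order.trans[OF norm_exp_euler_log_le[OF h(1)]] mult_mono 1) auto
  also have "\<dots> = exp ((pi\<^sup>2 - 23/24) / 12 / h)"
    using h by (simp add: field_simps flip: exp_add)
  also have "\<dots> \<le> exp (3 / 4 / h)"
  proof -
    have "pi\<^sup>2 \<le> (315/100)\<^sup>2" using pi_approx by (intro power_mono) auto
    then have "(pi\<^sup>2 - 23/24) / 12 \<le> 3/4" by (simp add: power2_eq_square)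
    then show ?thesis using h by (simp add: divide_right_mono del: divide_divide_eq_left)
  qed
  finally show ?thesis by simp
qed

section \<open>The Lambert series over a residue class\<close>

definition class_term :: "nat \<Rightarrow> nat \<Rightarrow> complex \<Rightarrow> nat \<Rightarrow> complex" where
  "class_term r t z m = exp (- z) ^ (m * t + r) / (1 + exp (- z) ^ (m * t + r))"

lemma class_term_eq_fermi: "class_term r t z m = fermi (of_nat (m * t + r) * z)"
proof -
  define w where "w = of_nat (m * t + r) * z"
  have "exp (- z) ^ (m * t + r) = exp (- w)"
    unfolding w_def using exp_of_nat_mult[of "m * t + r" "- z"] by (simp only: mult_minus_right)
  moreover have "1 + exp (- w) = (1 + exp w) * exp (- w)"
    by (simp add: distrib_right flip: exp_add)
  ultimately show ?thesis
    unfolding class_term_def fermi_def w_def[symmetric] by simp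
qed

text \<open>The exponent \<open>k = m * t + r\<close> is used twice: \<open>k \<ge> m\<close> in the
  numerator, and \<open>k \<ge> 1\<close> to keep the denominator at distance
  \<open>1 - exp (- Re z)\<close> from 0.\<close>

lemma norm_class_term_le:
  assumes "Re z > 0" "r > 0" "t > 0"
  shows "norm (class_term r t z m) \<le> exp (- Re z) ^ m / (1 - exp (- Re z))"
proof -
  define \<rho> where "\<rho> = exp (- Re z)"
  have \<rho>: "0 < \<rho>" "\<rho> < 1" using assms by (auto simp: \<rho>_def)
  define k where "k = m * t + r"
  have "m * 1 \<le> m * t" using assms by (intro mult_left_mono) auto
  then have k: "k \<ge> m" "k \<ge> 1" using assms unfolding k_def by linarith+
  have n: "norm (exp (- z) ^ k) = \<rho> ^ k" by (simp add: norm_power \<rho>_def)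
  have "\<rho> ^ k \<le> \<rho> ^ 1" using k \<rho> by (intro power_decreasing) auto
  then have "1 - \<rho> \<le> norm (1::complex) - norm (exp (- z) ^ k)" by (simp add: n)
  also have "\<dots> \<le> norm (1 + exp (- z) ^ k)" by (rule norm_diff_ineq)
  finally have d: "1 - \<rho> \<le> norm (1 + exp (- z) ^ k)" .
  have "norm (class_term r t z m) = \<rho> ^ k / norm (1 + exp (- z) ^ k)"
    by (simp add: class_term_def norm_divide n flip: k_def)
  also have "\<dots> \<le> \<rho> ^ m / (1 - \<rho>)"
    using d \<rho> k by (intro frac_le power_decreasing) auto
  finally show ?thesis by (simp add: \<rho>_def)
qed

lemma class_sum_bounds:
  assumes "Re z > 0" "r > 0" "t > 0"
  shows "summable (class_term r t z)"
    and "norm (\<Sum>m<N. class_term r t z m) \<le> 1 / (1 - exp (- Re z))\<^sup>2"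
    and "norm (suminf (class_term r t z)) \<le> 1 / (1 - exp (- Re z))\<^sup>2"
proof -
  have \<rho>: "0 < exp (- Re z)" "exp (- Re z) < 1" using assms by auto
  then have "(\<lambda>m. exp (- Re z) ^ m / (1 - exp (- Re z))) sums (1 / (1 - exp (- Re z)) / (1 - exp (- Re z)))"
    by (intro sums_divide geometric_sums) auto
  then have geo: "(\<lambda>m. exp (- Re z) ^ m / (1 - exp (- Re z))) sums (1 / (1 - exp (- Re z))\<^sup>2)"
    by (simp add: power2_eq_square)
  show "summable (class_term r t z)"
    using norm_class_term_le[OF assms]
    by (intro summable_comparison_test'[OF sums_summable[OF geo]]) auto
  show N: "norm (\<Sum>m<N. class_term r t z m) \<le> 1 / (1 - exp (- Re z))\<^sup>2" for N
  proof -
    have "norm (\<Sum>m<N. class_term r t z m) \<le> (\<Sum>m<N. exp (- Re z) ^ m / (1 - exp (- Re z)))"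
      by (intro order.trans[OF norm_sum] sum_mono norm_class_term_le assms)
    also have "\<dots> \<le> (\<Sum>m. exp (- Re z) ^ m / (1 - exp (- Re z)))"
      using \<rho> by (intro sum_le_suminf sums_summable[OF geo]) (auto intro!: divide_nonneg_nonneg)
    finally show ?thesis using sums_unique[OF geo] by simp
  qed
  then show "norm (suminf (class_term r t z)) \<le> 1 / (1 - exp (- Re z))\<^sup>2"
    using summable_LIMSEQ[OF \<open>summable _\<close>] by (intro Lim_bounded[OF tendsto_norm]) auto
qed

subsection \<open>The coefficient integral\<close>

text \<open>A partition into distinct parts is determined by its set of parts, and no part exceeds
  \<open>n\<close>. The free bound \<open>M\<close> allows truncated products of any length at least
  \<open>n\<close>.\<close>

lemma D_eq_sum_subsets:
  assumes "n \<le> M"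
  shows "D r t n = (\<Sum>S | S \<subseteq> {1..M} \<and> \<Sum>S = n. card (S \<inter> {k. [k = r] (mod t)}))"
  unfolding D_def
proof (rule sum.reindex_bij_witness[of _ mset_set set_mset])
  fix P assume P: "P \<in> distinct_partitions n"
  have count: "count P p = (if p \<in># P then 1 else 0)" for p
  proof -
    have "count P p \<le> 1" using P by (simp add: distinct_partitions_def)
    then show ?thesis
      by (metis One_nat_def le_Suc_eq le_zero_eq not_in_iff)
  qed
  show eq: "mset_set (set_mset P) = P"
    by (rule multiset_eqI) (simp only: count count_mset_set' finite_set_mset simp_thms if_True)
  have sum: "\<Sum>(set_mset P) = n"
    using P eq sum_unfold_sum_mset[of "\<lambda>x. x" "set_mset P"] by (simp add: distinct_partitions_def)
  have "set_mset P \<subseteq> {1..M}"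
  proof
    fix p assume p: "p \<in># P"
    then have "p \<le> \<Sum>\<^sub># P" by (auto dest!: multi_member_split)
    then show "p \<in> {1..M}"
      using P p assms by (auto simp: distinct_partitions_def Suc_le_eq)
  qed
  with sum show "set_mset P \<in> {S. S \<subseteq> {1..M} \<and> \<Sum>S = n}" by simp
  have "card (set_mset P \<inter> {k. [k = r] (mod t)}) = size (mset_set (set_mset P \<inter> {k. [k = r] (mod t)}))"
    by simp
  also have "mset_set (set_mset P \<inter> {k. [k = r] (mod t)}) = filter_mset (\<lambda>p. [p = r] (mod t)) (mset_set (set_mset P))"
    by (subst filter_mset_mset_set) (auto intro!: arg_cong[where f = mset_set])
  finally show "card (set_mset P \<inter> {k. [k = r] (mod t)}) = size {#p \<in># P. [p = r] (mod t)#}"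
    by (simp only: eq)
next
  fix S :: "nat set" assume S: "S \<in> {S. S \<subseteq> {1..M} \<and> \<Sum>S = n}"
  then have "finite S" by (auto intro: finite_subset)
  then show "set_mset (mset_set S) = S" by simp
  show "mset_set S \<in> distinct_partitions n"
    using S \<open>finite S\<close>
    by (auto simp: distinct_partitions_def count_mset_set' sum_unfold_sum_mset Suc_le_eq
        dest!: subsetD)
qed

lemma sum_Pow_insert:
  assumes "finite A" "a \<notin> A"
  shows "(\<Sum>S\<in>Pow (insert a A). f S) = (\<Sum>S\<in>Pow A. f S) + (\<Sum>S\<in>Pow A. f (insert a S))"
proof -
  have "inj_on (insert a) (Pow A)"
    using assms by (auto simp: inj_on_def)
  moreover have "Pow A \<inter> insert a ` Pow A = {}"
    using assms by auto
  ultimately show ?thesis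
    using assms by (simp add: Pow_insert sum.union_disjoint sum.reindex)
qed

lemma sum_Pow_power:
  fixes x :: "'a :: comm_ring_1"
  assumes "finite A"
  shows "(\<Sum>S\<in>Pow A. x ^ \<Sum>S) = (\<Prod>k\<in>A. 1 + x ^ k)"
  using assms
proof (induction rule: finite_induct)
  case (insert a A)
  have "(\<Sum>S\<in>Pow A. x ^ \<Sum>(insert a S)) = (\<Sum>S\<in>Pow A. x ^ a * x ^ \<Sum>S)"
  proof (rule sum.cong)
    fix S assume "S \<in> Pow A"
    then have "finite S" "a \<notin> S" using insert finite_subset by auto
    then show "x ^ \<Sum>(insert a S) = x ^ a * x ^ \<Sum>S" by (simp add: power_add)
  qed simp
  with insert show ?case
    by (simp add: sum_Pow_insert algebra_simps flip: sum_distrib_left)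
qed simp

text \<open>Formally the derivative at \<open>v = 1\<close> of the product in which each factor with
  \<open>k \<in> C\<close> is replaced by \<open>1 + v * x ^ k\<close>. The induction avoids the
  extra variable: adding \<open>a\<close> to a subset multiplies its power by \<open>x ^ a\<close>
  and raises the count by \<open>e\<close>.\<close>

lemma sum_Pow_card_power:
  fixes x :: "'a :: field"
  assumes "finite A" "\<And>k. k \<in> A \<Longrightarrow> 1 + x ^ k \<noteq> 0"
  shows "(\<Sum>S\<in>Pow A. of_nat (card (S \<inter> C)) * x ^ \<Sum>S)
    = (\<Prod>k\<in>A. 1 + x ^ k) * (\<Sum>k\<in>A \<inter> C. x ^ k / (1 + x ^ k))"
  using assms
proof (induction rule: finite_induct)
  case (insert a A)
  define e :: 'a where "e = (if a \<in> C then 1 else 0)"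
  have "(\<Sum>S\<in>Pow A. of_nat (card (insert a S \<inter> C)) * x ^ \<Sum>(insert a S))
      = (\<Sum>S\<in>Pow A. x ^ a * (of_nat (card (S \<inter> C)) * x ^ \<Sum>S) + e * x ^ a * x ^ \<Sum>S)"
  proof (rule sum.cong)
    fix S assume "S \<in> Pow A"
    then have S: "finite S" "a \<notin> S" using insert finite_subset by auto
    then show "of_nat (card (insert a S \<inter> C)) * x ^ \<Sum>(insert a S)
        = x ^ a * (of_nat (card (S \<inter> C)) * x ^ \<Sum>S) + e * x ^ a * x ^ \<Sum>S"
      by (simp add: power_add e_def Int_insert_left algebra_simps)
  qed simp
  also have "\<dots> = x ^ a * ((\<Prod>k\<in>A. 1 + x ^ k) * (\<Sum>k\<in>A \<inter> C. x ^ k / (1 + x ^ k)))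
      + e * x ^ a * (\<Prod>k\<in>A. 1 + x ^ k)"
    using insert by (simp add: sum.distrib sum_Pow_power flip: sum_distrib_left)
  finally have "(\<Sum>S\<in>Pow (insert a A). of_nat (card (S \<inter> C)) * x ^ \<Sum>S)
      = (1 + x ^ a) * ((\<Prod>k\<in>A. 1 + x ^ k) * (\<Sum>k\<in>A \<inter> C. x ^ k / (1 + x ^ k)))
        + e * x ^ a * (\<Prod>k\<in>A. 1 + x ^ k)"
    using insert by (simp add: sum_Pow_insert algebra_simps)
  also have "(\<Sum>k\<in>insert a A \<inter> C. x ^ k / (1 + x ^ k))
      = e * (x ^ a / (1 + x ^ a)) + (\<Sum>k\<in>A \<inter> C. x ^ k / (1 + x ^ k))"
    using insert by (simp add: Int_insert_left e_def)
  with insert.prems[of a] have "(1 + x ^ a) * ((\<Prod>k\<in>A. 1 + x ^ k) * (\<Sum>k\<in>A \<inter> C. x ^ k / (1 + x ^ k)))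
        + e * x ^ a * (\<Prod>k\<in>A. 1 + x ^ k) = 
      (\<Prod>k\<in>insert a A. 1 + x ^ k) * (\<Sum>k\<in>insert a A \<inter> C. x ^ k / (1 + x ^ k))"
    by (simp only: prod.insert[OF insert(1,2)]) (simp add: field_simps)
  finally show ?case .
qed simp

lemma has_integral_exp_int_multiple:
  "((\<lambda>y. exp (\<i> * of_int m * of_real y)) has_integral (if m = 0 then of_real (2 * pi) else 0)) {-pi..pi}"
proof (cases "m = 0")
  case True
  then show ?thesis
    using has_integral_const_real[of "1::complex" "-pi" pi] by (simp add: scaleR_conv_of_real)
next
  case False
  define F where "F = (\<lambda>y::real. exp (\<i> * of_int m * of_real y) / (\<i> * of_int m))"
  have "((\<lambda>y. exp (\<i> * of_int m * of_real y)) has_integral (F pi - F (-pi))) {-pi..pi}"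
  proof (rule fundamental_theorem_of_calculus)
    fix y assume "y \<in> {-pi..pi}"
    have "((\<lambda>w. exp (\<i> * of_int m * w) / (\<i> * of_int m)) has_field_derivative exp (\<i> * of_int m * of_real y)) (at (of_real y))"
      using False by (auto intro!: derivative_eq_intros)
    then show "(F has_vector_derivative exp (\<i> * of_int m * of_real y)) (at y within {-pi..pi})"
      unfolding F_def by (rule has_vector_derivative_real_field)
  qed simp
  moreover have "F pi - F (-pi) = 0"
  proof -
    have "exp (\<i> * of_int m * of_real pi) = exp (\<i> * of_int m * of_real (-pi))"
      by (subst exp_eq) (auto intro!: exI[of _ m])
    then show ?thesis by (simp add: F_def)
  qed
  ultimately show ?thesis using False by simp
qed

text \<open>For \<open>M \<ge> n\<close> the truncated product already has the right coefficient of
  order \<open>n\<close>. The integrand is a finite sum of exponentials, so the formula is exact and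
  follows from orthogonality.\<close>

lemma of_nat_D_has_integral:
  fixes h :: real
  assumes "h > 0" "n \<le> M"
  shows "((\<lambda>y. (\<Prod>k=1..M. 1 + exp (- Complex h y) ^ k)
              * (\<Sum>k\<in>{1..M} \<inter> {k. [k = r] (mod t)}. exp (- Complex h y) ^ k / (1 + exp (- Complex h y) ^ k))
              * exp (of_nat n * Complex h y))
          has_integral of_real (2 * pi) * of_nat (D r t n)) {-pi..pi}"
proof -
  let ?C = "{k. [k = r] (mod t)}"
  let ?A = "{1..M}"
  have nz: "1 + exp (- Complex h y) ^ k \<noteq> 0" if "k \<in> ?A" for y k
    using that assms by (intro norm_exp_minus_multiple(2)) auto
  have fin: "finite (Pow ?A)" by simp
  have "((\<lambda>y. \<Sum>S\<in>Pow ?A. of_nat (card (S \<inter> ?C)) * of_real (exp (h * (real n - real (\<Sum>S))))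
            * exp (\<i> * of_int (int n - int (\<Sum>S)) * of_real y))
         has_integral (\<Sum>S\<in>Pow ?A. of_nat (card (S \<inter> ?C)) * of_real (exp (h * (real n - real (\<Sum>S))))
            * (if int n - int (\<Sum>S) = 0 then of_real (2 * pi) else 0))) {-pi..pi}"
    by (intro has_integral_sum has_integral_mult_right has_integral_exp_int_multiple fin)
  also have "(\<Sum>S\<in>Pow ?A. of_nat (card (S \<inter> ?C)) * of_real (exp (h * (real n - real (\<Sum>S))))
            * (if int n - int (\<Sum>S) = 0 then of_real (2 * pi) else 0))
      = (\<Sum>S\<in>Pow ?A. if \<Sum>S = n then of_real (2 * pi) * complex_of_nat (card (S \<inter> ?C)) else 0)"
    by (rule sum.cong) (auto simp del: of_nat_sum)
  also have "\<dots> = (\<Sum>S\<in>{S\<in>Pow ?A. \<Sum>S = n}. of_real (2 * pi) * complex_of_nat (card (S \<inter> ?C)))"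
    by (subst sum.inter_filter) auto
  also have "\<dots> = of_real (2 * pi) * of_nat (D r t n)"
    by (simp add: D_eq_sum_subsets[OF assms(2)] Pow_def sum_distrib_left)
  also have "(\<lambda>y. \<Sum>S\<in>Pow ?A. of_nat (card (S \<inter> ?C)) * complex_of_real (exp (h * (real n - real (\<Sum>S))))
            * exp (\<i> * of_int (int n - int (\<Sum>S)) * of_real y))
     = (\<lambda>y. (\<Sum>S\<in>Pow ?A. of_nat (card (S \<inter> ?C)) * exp (- Complex h y) ^ \<Sum>S) * exp (of_nat n * Complex h y))"
    unfolding sum_distrib_right
    by (intro ext sum.cong refl) (simp add: Complex_eq algebra_simps exp_of_real flip: exp_of_nat_mult exp_add exp_of_real)
  also have "\<dots> = (\<lambda>y. (\<Prod>k\<in>?A. 1 + exp (- Complex h y) ^ k)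
              * (\<Sum>k\<in>?A \<inter> ?C. exp (- Complex h y) ^ k / (1 + exp (- Complex h y) ^ k))
              * exp (of_nat n * Complex h y))"
    by (subst sum_Pow_card_power) (use nz in auto)
  finally show ?thesis .
qed

subsection \<open>Major and minor arcs\<close>

definition lambert_main :: "real \<Rightarrow> complex \<Rightarrow> complex" where
  "lambert_main a u = of_real (ln 2) / u - of_real (bernoulli_coeff 1 a) / 2
     + of_real (bernoulli_coeff 2 a) * u / 4 - of_real (bernoulli_coeff 4 a) * u ^ 3 / 8"

definition euler_main :: "complex \<Rightarrow> complex" where
  "euler_main z = of_real (pi\<^sup>2) / (12 * z) - of_real (ln 2) / 2 + z / 24"

lemma norm_lambert_main_le:
  assumes a: "0 \<le> a" "a \<le> 1" and u: "u \<noteq> 0" "norm u \<le> 1"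
  shows "norm (lambert_main a u) \<le> 2 / norm u"
proof -
  define v where "v = norm u"
  have v: "0 < v" "v \<le> 1" using u by (auto simp: v_def)
  have "norm (lambert_main a u) \<le> norm (of_real (ln 2) / u) + norm (of_real (bernoulli_coeff 1 a) / 2 :: complex)
     + norm (of_real (bernoulli_coeff 2 a) * u / 4) + norm (of_real (bernoulli_coeff 4 a) * u ^ 3 / 8)"
    unfolding lambert_main_def
    by (intro order.trans[OF norm_triangle_ineq4] order.trans[OF norm_triangle_ineq] add_mono order.refl)
  also have "\<dots> = ln 2 / v + \<bar>bernoulli_coeff 1 a\<bar> / 2 + \<bar>bernoulli_coeff 2 a\<bar> * v / 4
      + \<bar>bernoulli_coeff 4 a\<bar> * v ^ 3 / 8"
    by (simp add: norm_mult norm_divide norm_power v_def)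
  \<comment> \<open>The three terms without \<open>1 / v\<close> add up to less than
    \<open>47/36 = 2 - 25/36\<close>, and \<open>v \<le> 1\<close> lets them be divided by
    \<open>v\<close>.\<close>
  also have "\<dots> \<le> (25/36) / v + (3/2) / 2 + (13/12) * 1 / 4 + (121/720) * 1 / 8"
    using bernoulli_coeff_bounds[OF a] v ln2_le_25_over_36
    by (intro add_mono divide_right_mono mult_mono power_le_one) auto
  also have "\<dots> \<le> 25/36 / v + 47/36 / v"
  proof -
    have "47/36 \<le> 47/36 / v" using v by (simp add: field_simps)
    then show ?thesis by simp
  qed
  also have "\<dots> = 2 / v" by (simp flip: add_divide_distrib)
  finally show ?thesis by (simp add: v_def)
qed

lemma norm_exp_minus_one_le:
  fixes d :: complex
  assumes "norm d \<le> 1/2"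
  shows "norm (exp d - 1) \<le> 2 * norm d"
proof -
  have "norm (exp d - (\<Sum>i\<le>0. exp 0 * (d - 0) ^ i / fact i)) \<le> 2 * norm (d - 0) ^ Suc 0 / fact 0"
  proof (rule complex_Taylor[where S = "cball 0 (1/2)" and f = "\<lambda>_. exp"])
    fix x :: complex assume "x \<in> cball 0 (1/2)"
    then show "norm (exp x) \<le> 2" by (intro exp_bound_half) auto
  qed (use assms in \<open>auto intro: DERIV_subset DERIV_exp\<close>)
  then show ?thesis by simp
qed

lemma norm_exp_euler_main_le:
  assumes h: "0 < h" "h \<le> 1"
  shows "norm (exp (euler_main (Complex h y))) \<le> exp (pi\<^sup>2 / 12 * (h / (h\<^sup>2 + y\<^sup>2)))"
proof -
  have "of_real (pi\<^sup>2) / (12 * z) = of_real (pi\<^sup>2 / 12) * inverse z" for z :: complex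
    by (simp add: divide_simps)
  then have "Re (euler_main (Complex h y)) = pi\<^sup>2 / 12 * (h / (h\<^sup>2 + y\<^sup>2)) - ln 2 / 2 + h / 24"
    by (simp add: euler_main_def del: of_real_power of_real_divide)
  then show ?thesis using ln2_ge_two_thirds h by simp
qed

lemma norm_sector_le:
  assumes "\<bar>Im z\<bar> \<le> Re z"
  shows "norm z \<le> 3/2 * Re z"
proof (rule power2_le_imp_le)
  have "norm z ^ 2 = (Re z)\<^sup>2 + (Im z)\<^sup>2" by (simp add: cmod_power2)
  also have "(Im z)\<^sup>2 \<le> (Re z)\<^sup>2" using power_mono[OF assms, of 2] by simp
  also have "(Re z)\<^sup>2 + (Re z)\<^sup>2 = 2 * (Re z)\<^sup>2" by simp
  also have "\<dots> \<le> 9/4 * (Re z)\<^sup>2" by (intro mult_right_mono) auto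
  finally show "norm z ^ 2 \<le> (3/2 * Re z) ^ 2" by (simp add: power_mult_distrib power_divide)
qed (use assms in auto)

text \<open>With \<open>d\<close> the error in the logarithm and \<open>u = t * z\<close>, the
  difference is \<open>exp (euler_main z)\<close> times \<open>exp d * (S - lambert_main a u) + (exp
  d - 1) * lambert_main a u\<close>. These two parts contribute 4000 and 400; the second gains a
  power from \<open>norm z \<le> norm u\<close>.\<close>

lemma major_arc_bound:
  fixes z :: complex and r t :: nat
  assumes z: "\<bar>Im z\<bar> \<le> Re z" "0 < Re z" "Re z * real t \<le> 1/12" and rt: "0 < r" "r \<le> t"
  shows "norm (exp (euler_log z) * suminf (class_term r t z)
            - exp (euler_main z) * lambert_main (real r / real t) (of_nat t * z))
         \<le> norm (exp (euler_main z)) * (4400 * norm (of_nat t * z) ^ 5)"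
proof -
  define u where "u = of_nat t * z"
  define a where "a = real r / real t"
  have t: "real t \<ge> 1" using rt by simp
  have a: "0 \<le> a" "a \<le> 1" using rt by (auto simp: a_def)
  have "Re z * 1 \<le> Re z * real t" using t z by (intro mult_left_mono) auto
  then have z': "Re z \<le> 1/12" using z(3) by linarith
  have u: "\<bar>Im u\<bar> \<le> Re u" "0 < Re u" "Re u \<le> 1/12"
    using z rt mult_left_mono[OF z(1), of "real t"] by (auto simp: u_def abs_mult mult.commute)
  then have u0: "u \<noteq> 0" by auto
  have nu: "norm u \<le> 1/8" "norm z \<le> 1/8" using norm_sector_le[of u] norm_sector_le[of z] u z z' by auto
  have zu: "norm z \<le> norm u"
    using mult_right_mono[OF t, of "norm z"] by (simp add: u_def norm_mult)
  obtain S where S: "(\<lambda>m. fermi ((of_nat m + of_real a) * u)) sums S"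
    "norm (S - lambert_main a u) \<le> 2000 * norm u ^ 5"
    using fermi_sum_asymp[OF u a] unfolding lambert_main_def by blast
  have "(\<lambda>m. fermi ((of_nat m + of_real a) * u)) = class_term r t z"
  proof
    fix m
    have "(of_nat m + of_real a) * u = of_nat (m * t + r) * z"
      using t by (simp add: a_def u_def field_simps)
    then show "fermi ((of_nat m + of_real a) * u) = class_term r t z m"
      by (simp add: class_term_eq_fermi)
  qed
  then have L: "suminf (class_term r t z) = S" using S(1) sums_unique by metis
  obtain T where T: "(\<lambda>m. Ln (1 + exp (- (of_nat (Suc m) * z)))) sums T"
    "norm (T - euler_main z) \<le> 100 * norm z ^ 6"
    using Ln_euler_sum_asymp[OF z(1,2) z'] unfolding euler_main_def by blast
  have E: "euler_log z = T" using T(1) euler_log_sums[OF z(2)] sums_unique2 by metis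
  define d where "d = T - euler_main z"
  have "norm z ^ 6 \<le> (1/8) ^ 6" using nu by (intro power_mono) auto
  then have d: "norm d \<le> 1/2" using T(2) by (simp add: d_def power_numeral_reduce)
  have ed: "norm (exp d - 1) \<le> 2 * (100 * norm u ^ 6)"
  proof -
    have "norm z ^ 6 \<le> norm u ^ 6" using zu by (intro power_mono) auto
    then have "norm d \<le> 100 * norm u ^ 6" using T(2) unfolding d_def by linarith
    then show ?thesis using norm_exp_minus_one_le[OF d] by simp
  qed
  have eT: "exp T = exp (euler_main z) * exp d" by (simp add: d_def exp_diff)
  have "exp (euler_log z) * suminf (class_term r t z) - exp (euler_main z) * lambert_main a u
      = exp (euler_main z) * (exp d * (S - lambert_main a u) + (exp d - 1) * lambert_main a u)"
    unfolding L E eT by (simp add: algebra_simps)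
  also have "norm \<dots> = norm (exp (euler_main z))
      * norm (exp d * (S - lambert_main a u) + (exp d - 1) * lambert_main a u)"
    by (rule norm_mult)
  also have "norm (exp d * (S - lambert_main a u) + (exp d - 1) * lambert_main a u)
      \<le> 2 * (2000 * norm u ^ 5) + 2 * (100 * norm u ^ 6) * (2 / norm u)"
  proof (intro order.trans[OF norm_triangle_ineq] add_mono)
    show "norm (exp d * (S - lambert_main a u)) \<le> 2 * (2000 * norm u ^ 5)"
      unfolding norm_mult using S(2) exp_bound_half[OF d] by (intro mult_mono) auto
    show "norm ((exp d - 1) * lambert_main a u) \<le> 2 * (100 * norm u ^ 6) * (2 / norm u)"
      unfolding norm_mult using ed norm_lambert_main_le[OF a u0] nu by (intro mult_mono) auto
  qed
  also have "\<dots> = 4400 * norm u ^ 5" using u0 by (simp add: power_numeral_reduce)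
  finally show ?thesis by (simp add: u_def a_def mult_left_mono)
qed

section \<open>Integral representations of \<open>D\<close> and of the main terms\<close>

text \<open>Cutting at a multiple of \<open>t\<close> makes the truncated residue class consist of
  exactly \<open>N\<close> terms.\<close>

lemma class_eq_image:
  fixes r t N :: nat
  assumes "0 < r" "r \<le> t"
  shows "{1..N * t} \<inter> {k. [k = r] (mod t)} = (\<lambda>m. m * t + r) ` {..<N}"
proof (intro equalityI subsetI)
  fix k assume k: "k \<in> {1..N * t} \<inter> {k. [k = r] (mod t)}"
  show "k \<in> (\<lambda>m. m * t + r) ` {..<N}"
  proof (cases "r \<le> k")
    case True
    then have "t dvd k - r" using k by (auto simp: cong_altdef_nat cong_sym_eq)
    then obtain m where m: "k - r = t * m" by (auto elim: dvdE)
    then have km: "k = m * t + r" using True by (simp add: mult.commute)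
    have "m * t + r \<le> N * t" using k km by simp
    then have "m * t < N * t" using assms by linarith
    then have "m < N" by simp
    then show ?thesis using km by auto
  next
    case False
    then have "t dvd r - k" using k by (simp add: cong_sym_eq[of k r] cong_altdef_nat)
    moreover have "0 < r - k" "r - k < t" using False k assms by auto
    ultimately show ?thesis using nat_dvd_not_less by blast
  qed
next
  fix k assume "k \<in> (\<lambda>m. m * t + r) ` {..<N}"
  then obtain m where m: "m < N" "k = m * t + r" by auto
  then have "Suc m * t \<le> N * t" by (intro mult_right_mono) auto
  then show "k \<in> {1..N * t} \<inter> {k. [k = r] (mod t)}"
    using m assms by (auto simp: cong_def)
qed

text \<open>Dominated convergence along the cutoffs \<open>(n + N) * t\<close>, all at least
  \<open>n\<close>, for which the truncated integrals have the same value. The products are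
  dominated by those at \<open>y = 0\<close>, the sums by the bound of
  \<open>class_sum_bounds\<close>.\<close>

lemma D_has_integral:
  fixes r t n :: nat
  assumes h: "h > 0" and rt: "0 < r" "r \<le> t"
  shows "((\<lambda>y. exp (euler_log (Complex h y)) * suminf (class_term r t (Complex h y)) * exp (of_nat n * Complex h y))
     has_integral of_real (2 * pi) * of_nat (D r t n)) {-pi..pi}"
proof -
  define P where "P = (\<lambda>y M. \<Prod>k=1..M. 1 + exp (- Complex h y) ^ k)"
  have t: "t > 0" using rt by simp
  have mono: "filterlim (\<lambda>N. (n + N) * t) sequentially sequentially"
  proof (rule filterlim_at_top_mono[OF filterlim_ident])
    have "N * 1 \<le> (n + N) * t" for N using t by (intro mult_mono) auto
    then show "\<forall>\<^sub>F N in sequentially. N \<le> (n + N) * t" by simp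
  qed
  have mono': "filterlim (\<lambda>N. n + N) sequentially sequentially"
    by (rule filterlim_at_top_mono[OF filterlim_ident]) simp
  have "Bseq (P 0)"
    unfolding P_def using h by (intro convergent_imp_Bseq convergentI[OF euler_prod_tendsto]) simp
  then obtain B where B: "B > 0" "\<And>M. norm (P 0 M) \<le> B" by (auto simp: Bseq_def)
  have PB: "norm (P y M) \<le> B" for y M
  proof -
    have "norm (P y M) \<le> (\<Prod>k=1..M. 1 + exp (- h) ^ k)"
      unfolding P_def prod_norm[symmetric]
      by (intro prod_mono conjI norm_ge_zero order.trans[OF norm_triangle_ineq])
         (simp add: norm_power)
    also have "\<dots> \<le> norm (P 0 M)"
    proof -
      have "P 0 M = of_real (\<Prod>k=1..M. 1 + exp (- h) ^ k)"
        unfolding P_def exp_minus_Complex_power by simp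
      then show ?thesis by (simp only: norm_of_real abs_ge_self)
    qed
    finally show ?thesis using B(2)[of M] by simp
  qed
  define C where "C = 1 / (1 - exp (- h))\<^sup>2"
  have 1: "((\<lambda>y. P y ((n + N) * t) * (\<Sum>m<n + N. class_term r t (Complex h y) m) * exp (of_nat n * Complex h y))
      has_integral of_real (2 * pi) * of_nat (D r t n)) {-pi..pi}" for N
  proof -
    have "n * 1 \<le> (n + N) * t" using t by (intro mult_mono) auto
    moreover have inj: "inj_on (\<lambda>m. m * t + r) {..<n + N}" using t by (auto simp: inj_on_def)
    ultimately show ?thesis
      using of_nat_D_has_integral[OF h, of n "(n + N) * t" r t]
      unfolding class_eq_image[OF rt] sum.reindex[OF inj] by (simp add: class_term_def P_def o_def)
  qed
  have 2: "(\<lambda>_. B * C * exp (real n * h)) integrable_on {-pi..pi}" by (rule integrable_const_ivl)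
  have 3: "\<forall>y\<in>{-pi..pi}. norm (P y ((n + N) * t) * (\<Sum>m<n + N. class_term r t (Complex h y) m) * exp (of_nat n * Complex h y))
      \<le> B * C * exp (real n * h)" for N
  proof
    fix y
    have "norm (\<Sum>m<n + N. class_term r t (Complex h y) m) \<le> C"
      using class_sum_bounds(2)[of "Complex h y" r t "n + N"] h rt by (simp add: C_def)
    moreover have "C \<ge> 0" by (simp add: C_def)
    moreover have "norm (exp (of_nat n * Complex h y)) = exp (real n * h)" by simp
    ultimately show "norm (P y ((n + N) * t) * (\<Sum>m<n + N. class_term r t (Complex h y) m)
        * exp (of_nat n * Complex h y)) \<le> B * C * exp (real n * h)"
      unfolding norm_mult using PB B(1) by (intro mult_mono) auto
  qed
  have 4: "\<forall>y\<in>{-pi..pi}. (\<lambda>N. P y ((n + N) * t) * (\<Sum>m<n + N. class_term r t (Complex h y) m) * exp (of_nat n * Complex h y))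
     \<longlonglongrightarrow> exp (euler_log (Complex h y)) * suminf (class_term r t (Complex h y)) * exp (of_nat n * Complex h y)"
  proof
    fix y
    have z: "Re (Complex h y) > 0" using h by simp
    show "(\<lambda>N. P y ((n + N) * t) * (\<Sum>m<n + N. class_term r t (Complex h y) m) * exp (of_nat n * Complex h y))
     \<longlonglongrightarrow> exp (euler_log (Complex h y)) * suminf (class_term r t (Complex h y)) * exp (of_nat n * Complex h y)"
      unfolding P_def
      by (intro tendsto_intros filterlim_compose[OF euler_prod_tendsto[OF z] mono]
          filterlim_compose[OF summable_LIMSEQ[OF class_sum_bounds(1)[OF z]] mono'] rt t)
  qed
  show ?thesis
    by (rule has_integral_dominated_convergence[OF 1 2 3 4 tendsto_const])
qed

text \<open>On the vertical segment \<open>dz = i dy\<close>, which cancels the \<open>i\<close> in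
  the prefactor of \<open>V\<close>.\<close>

lemma V_has_integral:
  assumes "n > 0"
  shows "((\<lambda>y. V_integrand s n (Complex (eta n) y)) has_integral
     of_real (2 * pi * sqrt 2) * V s n) {-10 * eta n..10 * eta n}"
proof -
  have "eta n > 0" using assms by (simp add: eta_def)
  then have "((\<lambda>y. V_integrand s n (Complex (eta n) y)) has_integral
     - \<i> * contour_integral (V_path n) (V_integrand s n)) {-10 * eta n..10 * eta n}"
    using has_contour_integral_integral[OF V_integrand_contour_integrable[OF assms, of s]]
    unfolding V_path_def by (subst (asm) has_contour_integral_linepath_same_Re_iff) auto
  also have "- \<i> * contour_integral (V_path n) (V_integrand s n) = of_real (2 * pi * sqrt 2) * V s n"
    by (simp add: V_def field_simps)
  finally show ?thesis .
qed

lemma exp_euler_main: "exp (euler_main z) = exp (of_real (pi\<^sup>2) / (12 * z) + z / 24) / of_real (sqrt 2)"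
proof -
  have "sqrt 2 = exp (ln 2 / 2)"
    using exp_ln[of "sqrt 2"] by (simp add: ln_sqrt)
  then have "complex_of_real (sqrt 2) = exp (of_real (ln 2) / 2)" by (simp add: exp_of_real[symmetric])
  then show ?thesis by (simp add: euler_main_def exp_add exp_diff)
qed

text \<open>The powers -1, 0, 1, 3 of \<open>z\<close> in \<open>lambert_main\<close> at
  \<open>t * z\<close> match \<open>V\<close> with \<open>s = 0, 1, 2, 4\<close>. The
  \<open>sqrt 2\<close> comes from \<open>- ln 2 / 2\<close> in \<open>euler_main\<close>, and the
  denominators from \<open>8 = 4 * 2!\<close> and \<open>192 = 8 * 4!\<close>.\<close>

lemma main_terms_has_integral:
  fixes r t n :: nat
  assumes "n > 0" "t > 0"
  shows "((\<lambda>y. exp (euler_main (Complex (eta n) y)) * lambert_main (real r / real t) (of_nat t * Complex (eta n) y)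
        * exp (of_nat n * Complex (eta n) y)) has_integral of_real (2 * pi) *
     (of_real (ln 2 / real t) * V 0 n
           - of_real (1 / 2 * bernpoly 1 (real r / real t)) * V 1 n
           + of_real (real t / 8 * bernpoly 2 (real r / real t)) * V 2 n
           - of_real (real t ^ 3 / 192 * bernpoly 4 (real r / real t)) * V 4 n)) {-10 * eta n..10 * eta n}"
proof -
  define a where "a = real r / real t"
  let ?I = "\<lambda>s y. V_integrand s n (Complex (eta n) y)"
  have "((\<lambda>y. (of_real (ln 2 / real t) * ?I 0 y - of_real (1 / 2 * bernpoly 1 a) * ?I 1 y
          + of_real (real t / 8 * bernpoly 2 a) * ?I 2 y - of_real (real t ^ 3 / 192 * bernpoly 4 a) * ?I 4 y)
          / of_real (sqrt 2)) has_integral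
       (of_real (ln 2 / real t) * (of_real (2 * pi * sqrt 2) * V 0 n)
           - of_real (1 / 2 * bernpoly 1 a) * (of_real (2 * pi * sqrt 2) * V 1 n)
           + of_real (real t / 8 * bernpoly 2 a) * (of_real (2 * pi * sqrt 2) * V 2 n)
           - of_real (real t ^ 3 / 192 * bernpoly 4 a) * (of_real (2 * pi * sqrt 2) * V 4 n))
        / of_real (sqrt 2)) {-10 * eta n..10 * eta n}"
    by (intro has_integral_divide has_integral_add has_integral_diff has_integral_mult_right
        V_has_integral[OF assms(1)])
  also have "(of_real (ln 2 / real t) * (of_real (2 * pi * sqrt 2) * V 0 n)
           - of_real (1 / 2 * bernpoly 1 a) * (of_real (2 * pi * sqrt 2) * V 1 n)
           + of_real (real t / 8 * bernpoly 2 a) * (of_real (2 * pi * sqrt 2) * V 2 n)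
           - of_real (real t ^ 3 / 192 * bernpoly 4 a) * (of_real (2 * pi * sqrt 2) * V 4 n))
        / of_real (sqrt 2) = of_real (2 * pi) * (of_real (ln 2 / real t) * V 0 n
           - of_real (1 / 2 * bernpoly 1 a) * V 1 n
           + of_real (real t / 8 * bernpoly 2 a) * V 2 n
           - of_real (real t ^ 3 / 192 * bernpoly 4 a) * V 4 n)"
  proof -
    have "complex_of_real (2 * pi * sqrt 2) = of_real (2 * pi) * of_real (sqrt 2)" by simp
    then have s: "c * (complex_of_real (2 * pi * sqrt 2) * v) = of_real (2 * pi) * (c * v) * of_real (sqrt 2)" for c v
      by (simp only: mult_ac)
    show ?thesis
      unfolding s left_diff_distrib[symmetric] distrib_right[symmetric] distrib_left[symmetric] right_diff_distrib[symmetric]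
      by simp
  qed
  also have "(\<lambda>y. (of_real (ln 2 / real t) * ?I 0 y - of_real (1 / 2 * bernpoly 1 a) * ?I 1 y
          + of_real (real t / 8 * bernpoly 2 a) * ?I 2 y - of_real (real t ^ 3 / 192 * bernpoly 4 a) * ?I 4 y)
          / of_real (sqrt 2))
      = (\<lambda>y. exp (euler_main (Complex (eta n) y)) * lambert_main a (of_nat t * Complex (eta n) y)
        * exp (of_nat n * Complex (eta n) y))"
  proof
    fix y
    define z where "z = Complex (eta n) y"
    have "eta n > 0" using assms by (simp add: eta_def)
    then have z: "z \<noteq> 0" by (auto simp: z_def complex_eq_iff)
    define W where "W = exp (of_real (pi\<^sup>2) / (12 * z) + (of_nat n + 1 / 24) * z)"
    have V: "V_integrand 0 n z = W / z" "V_integrand 1 n z = W"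
        "V_integrand 2 n z = z * W" "V_integrand 4 n z = z ^ 3 * W"
      unfolding V_integrand_def W_def[symmetric] by (simp_all add: power_int_minus divide_inverse)
    have L: "lambert_main a (of_nat t * z) = of_real (ln 2 / real t) / z - of_real (1 / 2 * bernpoly 1 a)
        + of_real (real t / 8 * bernpoly 2 a) * z - of_real (real t ^ 3 / 192 * bernpoly 4 a) * z ^ 3"
      by (simp add: lambert_main_def bernpoly_eq fact_numeral power_mult_distrib mult_ac)
    have e: "exp (of_real (pi\<^sup>2) / (12 * z) + z / 24) * exp (of_nat n * z) = W"
      unfolding W_def exp_add[symmetric] by (simp add: algebra_simps)
    have "exp (euler_main z) * lambert_main a (of_nat t * z) * exp (of_nat n * z)
        = W / of_real (sqrt 2) * lambert_main a (of_nat t * z)"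
      unfolding exp_euler_main e[symmetric] by simp
    also have "\<dots> = (of_real (ln 2 / real t) * (W / z) - of_real (1 / 2 * bernpoly 1 a) * W
          + of_real (real t / 8 * bernpoly 2 a) * (z * W) - of_real (real t ^ 3 / 192 * bernpoly 4 a) * (z ^ 3 * W))
          / of_real (sqrt 2)"
      unfolding L by (simp only: algebra_simps add_divide_distrib diff_divide_distrib times_divide_eq_left times_divide_eq_right divide_divide_eq_left)
    finally show "(of_real (ln 2 / real t) * ?I 0 y - of_real (1 / 2 * bernpoly 1 a) * ?I 1 y
          + of_real (real t / 8 * bernpoly 2 a) * ?I 2 y - of_real (real t ^ 3 / 192 * bernpoly 4 a) * ?I 4 y)
          / of_real (sqrt 2) = exp (euler_main (Complex (eta n) y)) * lambert_main a (of_nat t * Complex (eta n) y)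
        * exp (of_nat n * Complex (eta n) y)"
      unfolding z_def[symmetric] V by (rule sym)
  qed
  finally show ?thesis unfolding a_def .
qed

section \<open>Consequences of the choice of \<open>eta\<close>\<close>

lemma eta_facts:
  fixes t n :: nat
  assumes t: "t \<ge> 2" and n: "real n > 400 * real t ^ 2 / 3"
  shows "n > 0" "eta n > 0" "eta n * real t \<le> 1/12" "eta n \<le> 1/24"
    and "12 * real n * (eta n)\<^sup>2 = pi\<^sup>2"
    and "real n * eta n + pi\<^sup>2 / (12 * eta n) = pi * sqrt (real n / 3)"
    and "real n * eta n + 3 / (4 * eta n) = (3 * sqrt 3 / (2 * pi) + pi / sqrt 12) * sqrt (real n)"
proof -
  define s where "s = sqrt (12 * real n)"
  have "0 \<le> 400 * real t ^ 2 / 3" by simp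
  with n have n0: "real n > 0" by linarith
  then show "n > 0" by simp
  have s: "s > 0" "s\<^sup>2 = 12 * real n" using n0 by (auto simp: s_def)
  have h: "eta n = pi / s" by (simp add: eta_def s_def)
  show h0: "eta n > 0" using s by (simp add: h)
  \<comment> \<open>This is the hypothesis on \<open>n\<close> multiplied by 12; together with
    \<open>pi \<le> 10/3\<close> it gives \<open>eta n * t \<le> 1/12\<close>, the range in which
    the expansions hold.\<close>
  have "(40 * real t)\<^sup>2 \<le> s\<^sup>2" using n s by (simp add: power_mult_distrib)
  then have "40 * real t \<le> s" by (rule power2_le_imp_le) (use s in simp)
  moreover have "pi * real t \<le> 40/12 * real t" using pi_approx by (intro mult_right_mono) auto
  ultimately have st: "pi * real t \<le> 1/12 * s" by linarith
  have "eta n * real t = pi * real t / s" by (simp add: h)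
  also have "\<dots> \<le> 1/12" unfolding pos_divide_le_eq[OF s(1)] by (rule st)
  finally show ht: "eta n * real t \<le> 1/12" .
  have "eta n * 2 \<le> eta n * real t" using h0 t by (intro mult_left_mono) auto
  then show "eta n \<le> 1/24" using ht by linarith
  show "12 * real n * (eta n)\<^sup>2 = pi\<^sup>2" using s n0 by (simp add: h power_divide)
  have nh: "real n * eta n = pi * s / 12"
    using s by (simp add: h field_simps power2_eq_square)
  have "sqrt (real n / 3) = s / 6"
  proof (rule real_sqrt_unique)
    show "(s / 6)\<^sup>2 = real n / 3" by (simp add: power_divide s)
  qed (use s in auto)
  then show "real n * eta n + pi\<^sup>2 / (12 * eta n) = pi * sqrt (real n / 3)"
    unfolding nh using s by (simp add: h power2_eq_square)
  have 12: "sqrt 12 = 2 * sqrt 3" by (rule real_sqrt_unique) (auto simp: power_mult_distrib)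
  then have "s = 2 * sqrt 3 * sqrt (real n)" by (simp add: s_def real_sqrt_mult)
  then show "real n * eta n + 3 / (4 * eta n) = (3 * sqrt 3 / (2 * pi) + pi / sqrt 12) * sqrt (real n)"
    unfolding nh 12 by (simp add: h field_simps)
qed

section \<open>Pointwise bounds on the three ranges of \<open>y\<close>\<close>

lemma main_arc_pointwise:
  fixes r t n :: nat and h y :: real
  assumes h: "0 < h" "h * real t \<le> 1/12" and rt: "0 < r" "r \<le> t" and y: "\<bar>y\<bar> \<le> h"
  shows "norm (exp (euler_log (Complex h y)) * suminf (class_term r t (Complex h y)) * exp (of_nat n * Complex h y)
       - exp (euler_main (Complex h y)) * lambert_main (real r / real t) (of_nat t * Complex h y) * exp (of_nat n * Complex h y))
    \<le> exp (real n * h + pi\<^sup>2 / (12 * h)) * (4400 * (3/2 * (h * real t)) ^ 5)"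
proof -
  define z where "z = Complex h y"
  have "h * 1 \<le> h * real t" using h rt by (intro mult_left_mono) auto
  then have h1: "h \<le> 1" using h by linarith
  have nz: "norm z \<le> 3/2 * h" using norm_sector_le[of z] y by (simp add: z_def)
  have "norm (of_nat t * z) = real t * norm z" by (simp add: norm_mult)
  also have "\<dots> \<le> real t * (3/2 * h)" using nz by (intro mult_left_mono) auto
  also have "\<dots> = 3/2 * (h * real t)" by simp
  finally have u: "norm (of_nat t * z) \<le> 3/2 * (h * real t)" .
  have "h / (h\<^sup>2 + y\<^sup>2) \<le> h / h\<^sup>2" using h by (intro frac_le) auto
  then have "pi\<^sup>2 / 12 * (h / (h\<^sup>2 + y\<^sup>2)) \<le> pi\<^sup>2 / 12 * (h / h\<^sup>2)" by (intro mult_left_mono) auto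
  also have "\<dots> = pi\<^sup>2 / (12 * h)" using h by (simp add: power2_eq_square)
  finally have em: "norm (exp (euler_main z)) \<le> exp (pi\<^sup>2 / (12 * h))"
    unfolding z_def by (intro order.trans[OF norm_exp_euler_main_le[OF h(1) h1]]) simp
  have "norm (exp (euler_log z) * suminf (class_term r t z) * exp (of_nat n * z)
       - exp (euler_main z) * lambert_main (real r / real t) (of_nat t * z) * exp (of_nat n * z))
     = norm (exp (euler_log z) * suminf (class_term r t z)
       - exp (euler_main z) * lambert_main (real r / real t) (of_nat t * z)) * norm (exp (of_nat n * z))"
    by (simp only: norm_mult flip: left_diff_distrib)
  also have "\<dots> \<le> (norm (exp (euler_main z)) * (4400 * norm (of_nat t * z) ^ 5)) * norm (exp (of_nat n * z))"
    using h rt y by (intro mult_right_mono major_arc_bound) (auto simp: z_def)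
  also have "\<dots> \<le> (exp (pi\<^sup>2 / (12 * h)) * (4400 * (3/2 * (h * real t)) ^ 5)) * norm (exp (of_nat n * z))"
    using em u by (intro mult_right_mono mult_mono mult_left_mono power_mono) auto
  also have "\<dots> = exp (real n * h + pi\<^sup>2 / (12 * h)) * (4400 * (3/2 * (h * real t)) ^ 5)"
    by (simp add: z_def exp_add)
  finally show ?thesis by (simp only: z_def)
qed

lemma minor_arc_pointwise:
  fixes r t n :: nat and h y :: real
  assumes h: "0 < h" "h \<le> 1/24" and rt: "0 < r" "r \<le> t" and y: "h \<le> \<bar>y\<bar>" "\<bar>y\<bar> \<le> pi"
  shows "norm (exp (euler_log (Complex h y)) * suminf (class_term r t (Complex h y)) * exp (of_nat n * Complex h y))
     \<le> exp (real n * h + 3 / (4 * h)) * (6 / (5 * h\<^sup>2))"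
proof -
  define z where "z = Complex h y"
  have z: "Re z = h" by (simp add: z_def)
  have "exp (- h) \<le> 1 / (1 + h)"
    using exp_ge_add_one_self[of h] h by (simp add: exp_minus field_simps)
  then have "1 - exp (- h) \<ge> h / (1 + h)" using h by (simp add: field_simps)
  also have "h / (1 + h) \<ge> h / (25/24)" using h by (intro divide_left_mono) auto
  finally have "1 - exp (- h) \<ge> 24/25 * h" by simp
  then have "(24/25 * h)\<^sup>2 \<le> (1 - exp (- h))\<^sup>2" using h by (intro power_mono) auto
  then have "1 / (1 - exp (- h))\<^sup>2 \<le> 1 / (24/25 * h)\<^sup>2" using h by (intro divide_left_mono) auto
  also have "\<dots> = 625/576 * (1 / h\<^sup>2)" by (simp add: power_mult_distrib power_divide)
  also have "\<dots> \<le> 6/5 * (1 / h\<^sup>2)" by (intro mult_right_mono) auto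
  finally have "1 / (1 - exp (- Re z))\<^sup>2 \<le> 6 / (5 * h\<^sup>2)" by (simp add: z)
  then have L: "norm (suminf (class_term r t z)) \<le> 6 / (5 * h\<^sup>2)"
    using class_sum_bounds(3)[of z r t] h rt z by simp
  have "norm (exp (euler_log z) * suminf (class_term r t z) * exp (of_nat n * z))
      \<le> exp (3 / (4 * h)) * (6 / (5 * h\<^sup>2)) * exp (real n * h)"
    unfolding norm_mult
    using norm_exp_euler_log_minor[OF h y] L by (intro mult_mono) (auto simp: z_def)
  then show ?thesis by (simp add: z_def exp_add mult_ac)
qed

text \<open>For \<open>\<bar>y\<bar> \<ge> h\<close> the real part of \<open>1 / z\<close> is at
  most \<open>1 / (2 * h)\<close>, and \<open>pi^2 / 24 \<le> 3/4\<close>. The cutoff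
  \<open>10 * h\<close> keeps \<open>norm (t * z)\<close> at most \<open>11/12\<close>, while
  \<open>t \<ge> 2\<close> keeps it at least \<open>2 * h\<close>, so \<open>lambert_main\<close> is
  at most \<open>1 / h\<close>.\<close>

lemma main_terms_minor_pointwise:
  fixes r t n :: nat and h y :: real
  assumes h: "0 < h" "h * real t \<le> 1/12" "h \<le> 1/24" and rt: "0 < r" "r \<le> t" "t \<ge> 2"
    and y: "h \<le> \<bar>y\<bar>" "\<bar>y\<bar> \<le> 10 * h"
  shows "norm (exp (euler_main (Complex h y)) * lambert_main (real r / real t) (of_nat t * Complex h y) * exp (of_nat n * Complex h y))
     \<le> exp (real n * h + 3 / (4 * h)) * (1 / h)"
proof -
  define z where "z = Complex h y"
  have "h\<^sup>2 \<le> y\<^sup>2" using y h by (simp add: abs_le_square_iff[symmetric])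
  then have "h / (h\<^sup>2 + y\<^sup>2) \<le> h / (2 * h\<^sup>2)"
    using h by (intro frac_le) auto
  also have "\<dots> = 1 / (2 * h)" using h by (simp add: power2_eq_square)
  finally have "pi\<^sup>2 / 12 * (h / (h\<^sup>2 + y\<^sup>2)) \<le> pi\<^sup>2 / 12 * (1 / (2 * h))"
    by (intro mult_left_mono) auto
  also have "\<dots> \<le> (4\<^sup>2) / 12 * (1 / (2 * h))"
    using h pi_less_4 by (intro mult_right_mono divide_right_mono power_mono) auto
  also have "\<dots> \<le> 3 / (4 * h)" using h by (simp add: field_simps)
  finally have em: "norm (exp (euler_main z)) \<le> exp (3 / (4 * h))"
    unfolding z_def using h by (intro order.trans[OF norm_exp_euler_main_le]) auto
  have "norm z \<le> \<bar>Re z\<bar> + \<bar>Im z\<bar>" by (rule cmod_le)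
  then have "norm z \<le> 11 * h" using y h by (simp add: z_def)
  then have "real t * norm z \<le> real t * (11 * h)" by (intro mult_left_mono) auto
  also have "\<dots> = 11 * (h * real t)" by simp
  finally have u1: "norm (of_nat t * z) \<le> 1" using h by (simp add: norm_mult)
  have "h \<le> norm z" using abs_Re_le_cmod[of z] h by (simp add: z_def)
  then have "2 * h \<le> real t * norm z" using rt h by (intro mult_mono) auto
  then have u2: "2 * h \<le> norm (of_nat t * z)" by (simp add: norm_mult)
  have "norm (lambert_main (real r / real t) (of_nat t * z)) \<le> 2 / norm (of_nat t * z)"
    using u1 u2 h rt by (intro norm_lambert_main_le) auto
  also have "\<dots> \<le> 2 / (2 * h)" using u2 h by (intro frac_le) auto
  finally have L: "norm (lambert_main (real r / real t) (of_nat t * z)) \<le> 1 / h" by simp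
  have "norm (exp (euler_main z) * lambert_main (real r / real t) (of_nat t * z) * exp (of_nat n * z))
      \<le> exp (3 / (4 * h)) * (1 / h) * exp (real n * h)"
    unfolding norm_mult using em L h by (intro mult_mono) (auto simp: z_def)
  then show ?thesis by (simp add: z_def exp_add mult_ac)
qed

theorem theorem1p4:
  fixes r t n :: nat
  assumes "t \<ge> 2" and "0 < r" and "r \<le> t"
    and "real n > 400 * real t ^ 2 / 3"
  shows "cmod (of_nat (D r t n)
           - of_real (ln 2 / real t) * V 0 n
           + of_real (1 / 2 * bernpoly 1 (real r / real t)) * V 1 n
           - of_real (real t / 8 * bernpoly 2 (real r / real t)) * V 2 n
           + of_real (real t ^ 3 / 192 * bernpoly 4 (real r / real t)) * V 4 n)
         \<le> Err t n"
    (is "cmod ?lhs \<le> _")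
proof -
  define h where "h = eta n"
  note e = eta_facts[OF assms(1,4), folded h_def]
  note rt = assms(2,3)
  define F where "F = (\<lambda>y. exp (euler_log (Complex h y)) * suminf (class_term r t (Complex h y)) * exp (of_nat n * Complex h y))"
  define M where "M = (\<lambda>y. exp (euler_main (Complex h y)) * lambert_main (real r / real t) (of_nat t * Complex h y) * exp (of_nat n * Complex h y))"
  \<comment> \<open>Extending the main terms by 0 puts both integrals on the full circle; this needs
    \<open>10 * h \<le> pi\<close>.\<close>
  define K where "K = (\<lambda>y. F y - (if y \<in> {-10 * h..10 * h} then M y else 0))"
  define c1 where "c1 = exp (real n * h + pi\<^sup>2 / (12 * h)) * (4400 * (3/2 * (h * real t)) ^ 5)"
  define c2 where "c2 = exp (real n * h + 3 / (4 * h)) * (6 / (5 * h\<^sup>2) + 1 / h)"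
  have c: "c1 \<ge> 0" "c2 \<ge> 0" using e by (auto simp: c1_def c2_def)
  have hpi: "10 * h \<le> pi" using e(4) pi_gt3 by linarith
  obtain W where W: "(M has_integral of_real (2 * pi) * W) {-10 * h..10 * h}" "?lhs = of_nat (D r t n) - W"
    using main_terms_has_integral[OF e(1), of t r] assms(1) unfolding M_def h_def by force
  have "(K has_integral (of_real (2 * pi) * of_nat (D r t n) - of_real (2 * pi) * W)) {-pi..pi}"
    unfolding K_def
  proof (rule has_integral_diff)
    show "(F has_integral of_real (2 * pi) * of_nat (D r t n)) {-pi..pi}"
      unfolding F_def by (rule D_has_integral[OF e(2) rt])
    show "((\<lambda>y. if y \<in> {-10 * h..10 * h} then M y else 0) has_integral of_real (2 * pi) * W) {-pi..pi}"
      using has_integral_restrict_closed_subinterval[of M "of_real (2 * pi) * W" "-10 * h" "10 * h" "-pi" pi]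
        W(1) hpi e(2) by simp
  qed
  then have K: "K integrable_on {-pi..pi}" "integral {-pi..pi} K = of_real (2 * pi) * ?lhs"
    unfolding W(2) by (auto simp: right_diff_distrib integral_unique)
  \<comment> \<open>The constant \<open>c2\<close> is added for small \<open>y\<close> as well, so
    that a single majorant suffices and the interval need not be split.\<close>
  define g where "g = (\<lambda>y::real. (if y \<in> {-h..h} then c1 else 0) + c2)"
  have "(g has_integral (2 * h * c1 + 2 * pi * c2)) {-pi..pi}"
    unfolding g_def
  proof (rule has_integral_add)
    have "((\<lambda>_. c1) has_integral (2 * h * c1)) {-h..h}"
      using has_integral_const_real[of c1 "-h" h] e(2) by simp
    then show "((\<lambda>y. if y \<in> {-h..h} then c1 else 0) has_integral 2 * h * c1) {-pi..pi}"
      using has_integral_restrict_closed_subinterval[of "\<lambda>_. c1" "2 * h * c1" "-h" h "-pi" pi]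
        hpi e(2) by simp
    show "((\<lambda>y. c2) has_integral 2 * pi * c2) {-pi..pi}"
      using has_integral_const_real[of c2 "-pi" pi] by simp
  qed
  then have g: "g integrable_on {-pi..pi}" "integral {-pi..pi} g = 2 * h * c1 + 2 * pi * c2"
    by (auto simp: integral_unique)
  have Kg: "norm (K y) \<le> g y" if "y \<in> {-pi..pi}" for y
  proof (cases "\<bar>y\<bar> \<le> h")
    case True
    then have y: "y \<in> {-10 * h..10 * h}" "y \<in> {-h..h}" using e(2) by auto
    have "norm (F y - M y) \<le> c1"
      unfolding F_def M_def c1_def by (rule main_arc_pointwise[OF e(2,3) rt True])
    with y c show ?thesis by (simp add: K_def g_def)
  next
    case False
    then have y: "y \<notin> {-h..h}" "h \<le> \<bar>y\<bar>" "\<bar>y\<bar> \<le> pi" using that by auto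
    have F: "norm (F y) \<le> exp (real n * h + 3 / (4 * h)) * (6 / (5 * h\<^sup>2))"
      unfolding F_def by (rule minor_arc_pointwise[OF e(2,4) rt y(2,3)])
    have "norm (if y \<in> {-10 * h..10 * h} then M y else 0) \<le> exp (real n * h + 3 / (4 * h)) * (1 / h)"
    proof (cases "y \<in> {-10 * h..10 * h}")
      case True
      then have "\<bar>y\<bar> \<le> 10 * h" by auto
      from main_terms_minor_pointwise[OF e(2,3,4) rt assms(1) y(2) this] True show ?thesis
        by (simp add: M_def)
    qed (use e(2) in auto)
    with F have "norm (K y) \<le> exp (real n * h + 3 / (4 * h)) * (6 / (5 * h\<^sup>2)) + exp (real n * h + 3 / (4 * h)) * (1 / h)"
      unfolding K_def by (intro order.trans[OF norm_triangle_ineq4] add_mono)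
    moreover have "g y = c2" unfolding g_def using y(1) by (simp only: if_False add_0)
    ultimately show ?thesis by (simp add: c2_def distrib_left)
  qed
  have "2 * pi * cmod ?lhs = norm (integral {-pi..pi} K)"
    unfolding K(2) by (simp only: norm_mult norm_of_real) simp
  also have "\<dots> \<le> 2 * h * c1 + 2 * pi * c2"
    using integral_norm_bound_integral[OF K(1) g(1) Kg] g(2) by simp
  finally have "cmod ?lhs \<le> h * c1 / pi + c2"
    by (simp add: field_simps)
  also have "h * c1 / pi \<le> 14381 * real t ^ 5 / real n ^ 3 * exp (pi * sqrt (real n / 3))"
  proof -
    have h2: "h\<^sup>2 = pi\<^sup>2 / (12 * real n)" using e(1,5) by (simp add: field_simps)
    have "h * h ^ 5 = (h\<^sup>2) ^ 3" by (simp add: power_numeral_reduce)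
    also have "\<dots> = pi ^ 6 / (1728 * real n ^ 3)"
      unfolding h2 by (simp add: power_divide power_mult_distrib flip: power_mult)
    finally have h6: "h * h ^ 5 = pi ^ 6 / (1728 * real n ^ 3)" .
    have "h * c1 / pi = exp (pi * sqrt (real n / 3)) * (4400 * (3/2) ^ 5) * real t ^ 5 * (h * h ^ 5) / pi"
    proof -
      have p: "(3/2 * (h * real t)) ^ 5 = (3/2) ^ 5 * real t ^ 5 * h ^ 5"
        by (simp only: power_mult_distrib mult_ac)
      show ?thesis unfolding c1_def e(6) p by (simp only: mult_ac times_divide_eq_right)
    qed
    also have "\<dots> = (4400 * (3/2) ^ 5 / 1728 * pi ^ 5) * (real t ^ 5 / real n ^ 3 * exp (pi * sqrt (real n / 3)))"
      unfolding h6 by (simp add: power_numeral_reduce)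
    \<comment> \<open>The numerical factor is below 6000, so there is ample room.\<close>
    also have "\<dots> \<le> 14381 * (real t ^ 5 / real n ^ 3 * exp (pi * sqrt (real n / 3)))"
    proof (rule mult_right_mono)
      have "pi ^ 5 \<le> (315/100) ^ 5" using pi_approx by (intro power_mono) auto
      then show "4400 * (3/2) ^ 5 / 1728 * pi ^ 5 \<le> 14381" by (simp add: power_numeral_reduce)
    qed auto
    finally show ?thesis by simp
  qed
  also have "c2 \<le> 9 * real n * exp ((3 * sqrt 3 / (2 * pi) + pi / sqrt 12) * sqrt (real n))"
  proof -
    have "h * h \<le> h * 1" using e by (intro mult_left_mono) auto
    then have "1 / h \<le> 1 / h\<^sup>2" using e(2) by (intro divide_left_mono) (auto simp: power2_eq_square)
    \<comment> \<open>With \<open>1 / h^2 = 12 * n / pi^2\<close> and \<open>pi > 3\<close> the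
      right-hand side is less than \<open>3 * n\<close>.\<close>
    then have "6 / (5 * h\<^sup>2) + 1 / h \<le> 11/5 * (1 / h\<^sup>2)" by simp
    also have "1 / h\<^sup>2 = 12 * real n / pi\<^sup>2" using e(1,2,5) by (simp add: field_simps)
    also have "\<dots> \<le> 12 * real n / 3\<^sup>2"
      using pi_gt3 by (intro divide_left_mono power_mono) auto
    finally have "6 / (5 * h\<^sup>2) + 1 / h \<le> 9 * real n" by simp
    then have "c2 \<le> exp (real n * h + 3 / (4 * h)) * (9 * real n)"
      unfolding c2_def by (intro mult_left_mono) auto
    then show ?thesis unfolding e(7) by (simp add: mult_ac)
  qed
  also have "14381 * real t ^ 5 / real n ^ 3 * exp (pi * sqrt (real n / 3)) +
      9 * real n * exp ((3 * sqrt 3 / (2 * pi) + pi / sqrt 12) * sqrt (real n)) \<le> Err t n"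
    by (simp add: Err_def)
  finally show ?thesis by simp
qed

end
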